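(* Let $(M,X,Z)$ be a triple satisfying condition (A) (see context). Let $\psi<-T$ and $\tilde\psi<-T$ be plurisubharmonic functions on $M$, and let $\varphi,\tilde\varphi$ be Lebesgue measurable functions on $M$ such that $\varphi+\psi$ and $\tilde\varphi+\tilde\psi$ are plurisubharmonic on $M$. Let $(Z_0,\mathcal{F})$ and $(\tilde Z_0,\tilde{\mathcal{F}})$ be data as in the context associated with $(\varphi,\psi)$ and $(\tilde\varphi,\tilde\psi)$ respectively, with the same $(n,0)$ form $f$. Let $T_1,T_2\in[T,+\infty)$ with $T_1<T_2$. Let $c\in\mathcal{P}_{T,M,\varphi,\psi}$ satisfy $\int_{T_2}^{+\infty}c(t)e^{-t}\,dt<+\infty$ and let $\tilde c\in\mathcal{P}_{T,M,\tilde\varphi,\tilde\psi}$ satisfy $\int_{T_2}^{+\infty}\tilde c(t)e^{-t}\,dt<+\infty$. Assume that (1) $\tilde\psi<-T_1$ on $\{\psi<-T_1\}$, and $\tilde\psi<-T_2$ on $\{\psi<-T_2\}$; (2) $\tilde\psi=\psi$ and $\tilde\varphi=\varphi$ on $\{-T_2\le\psi<-T_1\}$; (3) $\tilde Z_0=Z_0$, $\mathcal{I}(\tilde\psi+\tilde\varphi)|_{Z_0}\subset\mathcal{I}(\psi+\varphi)|_{Z_0}$ and $\mathcal{F}|_{Z_0}\subset\tilde{\mathcal{F}}|_{Z_0}$; (4) $\mathcal{H}^2(\tilde c,t,\tilde\varphi,\tilde\psi)\supset\mathcal{H}^2(c,t,\varphi,\psi)$ for any $t\in[T_1,T_2]$.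 Suppose that $G(\tilde h^{-1}(r);\tilde\varphi,\tilde\psi,\tilde c)$ is linear with respect to $r\in\left[\int_{T_2}^{+\infty}\tilde c(s)e^{-s}\,ds,\int_{T_1}^{+\infty}\tilde c(s)e^{-s}\,ds\right]$, where $\tilde h(t)=\int_t^{+\infty}\tilde c(l)e^{-l}\,dl$, and that the (unique) holomorphic $(n,0)$ form $\tilde F$ on $\{\tilde\psi<-T_1\}$ with $(\tilde F-f)\in H^0(\tilde Z_0,(\mathcal{O}(K_M)\otimes\tilde{\mathcal{F}})|_{\tilde Z_0})$ and $$\int_{\{\tilde\psi<-t\}}|\tilde F|^2e^{-\tilde\varphi}\tilde c(-\tilde\psi)=G(t;\tilde\varphi,\tilde\psi,\tilde c)\quad\text{for all }t\in[T_1,T_2]$$ also satisfies $$\int_{\{\psi<-T_2\}}|\tilde F|^2e^{-\varphi}c(-\psi)=G(T_2;\varphi,\psi,c).$$ Then $G(h^{-1}(r);\varphi,\psi,c)$ is linear with respect to $r\in\left[\int_{T_2}^{+\infty}c(s)e^{-s}\,ds,\int_{T_1}^{+\infty}c(s)e^{-s}\,ds\right]$, where $h(t)=\int_t^{+\infty}c(l)e^{-l}\,dl$.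
   Context: Let $M$ be an $n$-dimensional complex manifold with canonical line bundle $K_M$, and let $X,Z$ be closed subsets of $M$. The triple $(M,X,Z)$ satisfies condition (A) if: (1) $X$ is closed and locally negligible with respect to $L^2$ holomorphic functions, i.e. for any coordinate neighborhood $V\subset M$ and any $L^2$ holomorphic function $g$ on $V\setminus X$ there is an $L^2$ holomorphic function $\tilde g$ on $V$ with $\tilde g|_{V\setminus X}=g$ and the same $L^2$ norm; (2) $Z$ is an analytic subset of $M$ and $M\setminus(X\cup Z)$ is a weakly pseudoconvex Kähler manifold. For a plurisubharmonic function $\Phi$, $\mathcal{I}(\Phi)$ is the multiplier ideal sheaf, i.e. the sheaf of germs of holomorphic functions $g$ with $|g|^2e^{-\Phi}$ locally integrable. Given a plurisubharmonic $\psi<-T$ and a measurable $\varphi$ with $\varphi+\psi$ plurisubharmonic: The class $\mathcal{P}_{T,M,\varphi,\psi}$ consists of the positive measurable functions $c$ on $(T,+\infty)$ such that (1) $c(t)e^{-t}$ is decreasing in $t$; (2) there is a closed subset $E$ of $M$ with $E\subset Z\cap\{\psi=-\infty\}$ such that for any compact $K\subset M\setminus E$, $e^{-\varphi}c(-\psi)$ has a positive lower bound on $K$. Data $(Z_0,\mathcal{F})$ associated with $(\varphi,\psi)$: $Z_0$ is a subset of $\{\psi=-\infty\}$ with $Z_0\cap\mathrm{Supp}(\mathcal{O}/\mathcal{I}(\varphi+\psi))\ne\emptyset$, and for each $z_0\in Z_0$, $\mathcal{F}_{z_0}\supset\mathcal{I}(\varphi+\psi)_{z_0}$ is an ideal of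 $\mathcal{O}_{z_0}$. $f$ is a holomorphic $(n,0)$ form on an open set $U\supset Z_0$. The notation $(\tilde f-f)\in H^0(Z_0,(\mathcal{O}(K_M)\otimes\mathcal{F})|_{Z_0})$ means that the germ $(\tilde f-f,z_0)$ lies in $(\mathcal{O}(K_M)\otimes\mathcal{F})_{z_0}$ for every $z_0\in Z_0$. Inclusions such as $\mathcal{F}|_{Z_0}\subset\tilde{\mathcal{F}}|_{Z_0}$ mean inclusion of the ideals at every point of $Z_0$. For an $(n,0)$ form $\tilde f$, $|\tilde f|^2:=\sqrt{-1}^{\,n^2}\tilde f\wedge\overline{\tilde f}$. For $t\in[T,+\infty)$, $\mathcal{H}^2(c,t,\varphi,\psi)$ is the set of $\tilde f\in H^0(\{\psi<-t\},\mathcal{O}(K_M))$ with $\int_{\{\psi<-t\}}|\tilde f|^2e^{-\varphi}c(-\psi)<+\infty$ and $(\tilde f-f)\in H^0(Z_0,(\mathcal{O}(K_M)\otimes\mathcal{F})|_{Z_0})$, and $$G(t;\varphi,\psi,c):=\inf\left\{\int_{\{\psi<-t\}}|\tilde f|^2e^{-\varphi}c(-\psi):\ \tilde f\in H^0(\{\psi<-t\},\mathcal{O}(K_M)),\ (\tilde f-f)\in H^0(Z_0,(\mathcal{O}(K_M)\otimes\mathcal{F})|_{Z_0})\right\},$$ with value $+\infty$ if no such $\tilde f$ exists. $\mathcal{H}^2(\tilde c,t,\tilde\varphi,\tilde\psi)$ and $G(t;\tilde\varphi,\tilde\psi,\tilde c)$ are defined in the same way using $\tilde Z_0$, $\tilde{\mathcal{F}}$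 and the same $f$. "Linear" on an interval means of the form $r\mapsto\alpha r+\beta$ there; $h^{-1},\tilde h^{-1}$ are inverse functions.
   Formalization: The equality for F̃ at T_2 is read as: F̃ attains a finite minimum, i.e. F̃ on {ψ<-T_2} lies in H^2(c,T_2,φ,ψ), so G(T_2;φ,ψ,c) is finite and F̃-f lies in F on Z_0. With bare numerical equality the claim is false (∞=∞, or accidental equality). *)

theory Defs
  imports "HOL-Analysis.Analysis" "HOL-Algebra.Ideal"
begin

section \<open>Holomorphic and smooth functions on open subsets of complex n-space\<close>

definition holo_fun :: "(complex^'n \<Rightarrow> complex) \<Rightarrow> (complex^'n) set \<Rightarrow> bool" where
  "holo_fun f S \<longleftrightarrow> open S \<and>
     (\<forall>z\<in>S. \<exists>L. (f has_derivative L) (at z) \<and> (\<forall>c v. L (c *s v) = c * L v))"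

definition holo_map :: "(complex^'n \<Rightarrow> complex^'m) \<Rightarrow> (complex^'n) set \<Rightarrow> bool" where
  "holo_map f S \<longleftrightarrow> (\<forall>j. holo_fun (\<lambda>z. f z $ j) S)"

definition complex_jacobian :: "(complex^'n \<Rightarrow> complex^'n) \<Rightarrow> complex^'n \<Rightarrow> complex^'n^'n" where
  "complex_jacobian f z = (\<chi> i j. frechet_derivative f (at z) (axis j 1) $ i)"

definition wirtinger :: "'n \<Rightarrow> (complex^'n \<Rightarrow> complex) \<Rightarrow> complex^'n \<Rightarrow> complex" where
  "wirtinger l f z = (frechet_derivative f (at z) (axis l 1)
       - \<i> * frechet_derivative f (at z) (axis l \<i>)) / 2"

fun Ck_on :: "nat \<Rightarrow> ('v::real_normed_vector \<Rightarrow> 'w::real_normed_vector) \<Rightarrow> 'v set \<Rightarrow> bool" where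
  "Ck_on 0 f S \<longleftrightarrow> continuous_on S f"
| "Ck_on (Suc k) f S \<longleftrightarrow> (\<forall>x\<in>S. f differentiable (at x)) \<and>
     (\<forall>v. Ck_on k (\<lambda>x. frechet_derivative f (at x) v) S)"

definition smooth_fun :: "('v::real_normed_vector \<Rightarrow> 'w::real_normed_vector) \<Rightarrow> 'v set \<Rightarrow> bool" where
  "smooth_fun f S \<longleftrightarrow> open S \<and> (\<forall>k. Ck_on k f S)"


section \<open>Complex manifolds\<close>

text \<open>
  A chart is an open set together with a coordinate map; the values of the map outside
  the open set are irrelevant.  The underlying space of the manifold is the whole type
  \<^typ>\<open>'a\<close>, and its complex structure is a maximal holomorphic atlas, so that
  the members of the atlas are exactly the coordinate neighbourhoods.
\<close>

type_synonym ('a, 'n) chart = "'a set \<times> ('a \<Rightarrow> complex^'n)"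

abbreviation chart_inv :: "('a, 'n) chart \<Rightarrow> complex^'n \<Rightarrow> 'a" where
  "chart_inv C \<equiv> inv_into (fst C) (snd C)"

definition is_chart :: "('a::topological_space, 'n::finite) chart \<Rightarrow> bool" where
  "is_chart C \<longleftrightarrow> open (fst C) \<and> open (snd C ` fst C) \<and>
     homeomorphism (fst C) (snd C ` fst C) (snd C) (chart_inv C)"

definition transition :: "('a, 'n::finite) chart \<Rightarrow> ('a, 'n) chart \<Rightarrow> complex^'n \<Rightarrow> complex^'n" where
  "transition C D = snd D \<circ> chart_inv C"

definition charts_compatible :: "('a::topological_space, 'n::finite) chart \<Rightarrow> ('a, 'n) chart \<Rightarrow> bool" where
  "charts_compatible C D \<longleftrightarrow>
     holo_map (transition C D) (snd C ` (fst C \<inter> fst D)) \<and>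
     holo_map (transition D C) (snd D ` (fst C \<inter> fst D))"

definition complex_manifold ::
  "('a::{t2_space, second_countable_topology}, 'n::finite) chart set \<Rightarrow> bool" where
  "complex_manifold \<A> \<longleftrightarrow>
     (\<forall>C\<in>\<A>. is_chart C) \<and> (\<Union>C\<in>\<A>. fst C) = UNIV \<and>
     (\<forall>C\<in>\<A>. \<forall>D\<in>\<A>. charts_compatible C D) \<and>
     (\<forall>C. is_chart C \<and> (\<forall>D\<in>\<A>. charts_compatible C D) \<longrightarrow> C \<in> \<A>)"

definition mfd_holo ::
  "('a::topological_space, 'n::finite) chart set \<Rightarrow> 'a set \<Rightarrow> ('a \<Rightarrow> complex) \<Rightarrow> bool" where
  "mfd_holo \<A> W g \<longleftrightarrow> open W \<and> (\<forall>C\<in>\<A>. holo_fun (g \<circ> chart_inv C) (snd C ` (fst C \<inter> W)))"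

definition mfd_smooth ::
  "('a::topological_space, 'n::finite) chart set \<Rightarrow> 'a set \<Rightarrow> ('a \<Rightarrow> real) \<Rightarrow> bool" where
  "mfd_smooth \<A> W g \<longleftrightarrow> open W \<and> (\<forall>C\<in>\<A>. smooth_fun (g \<circ> chart_inv C) (snd C ` (fst C \<inter> W)))"

definition mfd_measurable ::
  "('a::topological_space, 'n::finite) chart set \<Rightarrow> ('a \<Rightarrow> ereal) \<Rightarrow> bool" where
  "mfd_measurable \<A> \<phi> \<longleftrightarrow>
     (\<forall>C\<in>\<A>. \<phi> \<circ> chart_inv C \<in> borel_measurable (lebesgue_on (snd C ` fst C)))"

definition analytic_subset ::
  "('a::topological_space, 'n::finite) chart set \<Rightarrow> 'a set \<Rightarrow> bool" where
  "analytic_subset \<A> Z \<longleftrightarrow>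
     (\<forall>p. \<exists>W S. open W \<and> p \<in> W \<and> finite S \<and> (\<forall>g\<in>S. mfd_holo \<A> W g) \<and>
        Z \<inter> W = {x\<in>W. \<forall>g\<in>S. g x = 0})"


section \<open>Plurisubharmonic functions, weak pseudoconvexity, Kaehler metrics\<close>

text \<open>
  The mean over the circle with centre \<open>z\<close> and radius vector \<open>w\<close>, for functions with values
  in the extended reals that are bounded above on the circle: the integral of the positive
  part is then finite, so that the difference is meaningful (possibly minus infinity).
  Note that \<^const>\<open>e2ennreal\<close> maps negative values to 0.
\<close>

definition circle_mean :: "(complex^'n \<Rightarrow> ereal) \<Rightarrow> complex^'n \<Rightarrow> complex^'n \<Rightarrow> ereal" where
  "circle_mean u z w =
     (enn2ereal (\<integral>\<^sup>+ \<theta>. e2ennreal (u (z + cis \<theta> *s w)) * indicator {0..2*pi} \<theta> \<partial>lborel)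
      - enn2ereal (\<integral>\<^sup>+ \<theta>. e2ennreal (- u (z + cis \<theta> *s w)) * indicator {0..2*pi} \<theta> \<partial>lborel))
     / ereal (2 * pi)"

definition psh_coord :: "(complex^'n \<Rightarrow> ereal) \<Rightarrow> (complex^'n) set \<Rightarrow> bool" where
  "psh_coord u S \<longleftrightarrow> open S \<and> (\<forall>z\<in>S. u z < \<infinity>) \<and>
     (\<forall>a. open {z\<in>S. u z < a}) \<and>
     (\<forall>z w. (\<forall>\<zeta>. cmod \<zeta> \<le> 1 \<longrightarrow> z + \<zeta> *s w \<in> S) \<longrightarrow> u z \<le> circle_mean u z w)"

text \<open>As usual, a plurisubharmonic function is not identically minus infinity on any component.\<close>

definition psh ::
  "('a::topological_space, 'n::finite) chart set \<Rightarrow> 'a set \<Rightarrow> ('a \<Rightarrow> ereal) \<Rightarrow> bool" where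
  "psh \<A> W u \<longleftrightarrow> open W \<and>
     (\<forall>C\<in>\<A>. psh_coord (u \<circ> chart_inv C) (snd C ` (fst C \<inter> W))) \<and>
     interior {x\<in>W. u x = -\<infinity>} = {}"

text \<open>
  \<open>\<phi> + \<psi>\<close> is plurisubharmonic: it agrees with a plurisubharmonic function wherever the sum
  of the two extended real values is meaningful.  Here \<open>\<psi>\<close> is plurisubharmonic, so the sum
  can only be meaningless on the null set where \<open>\<psi> = -\<infinity>\<close> and \<open>\<phi> = \<infinity>\<close>.
\<close>

definition psh_sum ::
  "('a::topological_space, 'n::finite) chart set \<Rightarrow> ('a \<Rightarrow> ereal) \<Rightarrow> ('a \<Rightarrow> ereal) \<Rightarrow> bool" where
  "psh_sum \<A> \<phi> \<psi> \<longleftrightarrow>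
     (\<exists>\<Theta>. psh \<A> UNIV \<Theta> \<and> (\<forall>x. \<not> (\<phi> x = \<infinity> \<and> \<psi> x = -\<infinity>) \<longrightarrow> \<Theta> x = \<phi> x + \<psi> x))"

definition weakly_pseudoconvex ::
  "('a::topological_space, 'n::finite) chart set \<Rightarrow> 'a set \<Rightarrow> bool" where
  "weakly_pseudoconvex \<A> W \<longleftrightarrow>
     (\<exists>\<rho> :: 'a \<Rightarrow> real. mfd_smooth \<A> W \<rho> \<and> psh \<A> W (\<lambda>x. ereal (\<rho> x)) \<and>
        (\<forall>a. compact {x\<in>W. \<rho> x \<le> a}))"

text \<open>
  A Kaehler metric on \<open>W\<close>, given by its positive definite Hermitian coefficient matrices
  \<open>g C p\<close> with respect to the charts \<open>C\<close> around \<open>p\<close>; the last condition says that the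
  fundamental form is closed.
\<close>

definition kaehler_metric ::
  "('a::topological_space, 'n::finite) chart set \<Rightarrow> 'a set \<Rightarrow>
   (('a, 'n) chart \<Rightarrow> 'a \<Rightarrow> complex^'n^'n) \<Rightarrow> bool" where
  "kaehler_metric \<A> W g \<longleftrightarrow>
     (\<forall>C\<in>\<A>. \<forall>p\<in>fst C \<inter> W.
        (\<forall>j k. g C p $ k $ j = cnj (g C p $ j $ k)) \<and>
        (\<forall>v. v \<noteq> 0 \<longrightarrow> 0 < Re (\<Sum>j\<in>UNIV. \<Sum>k\<in>UNIV. g C p $ j $ k * v $ j * cnj (v $ k)))) \<and>
     (\<forall>C\<in>\<A>. \<forall>D\<in>\<A>. \<forall>p\<in>fst C \<inter> fst D \<inter> W. \<forall>j k.
        g C p $ j $ k =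
          (let J = complex_jacobian (transition C D) (snd C p)
           in \<Sum>l\<in>UNIV. \<Sum>m\<in>UNIV. g D p $ l $ m * J $ l $ j * cnj (J $ m $ k))) \<and>
     (\<forall>C\<in>\<A>. \<forall>j k. smooth_fun (\<lambda>z. g C (chart_inv C z) $ j $ k) (snd C ` (fst C \<inter> W))) \<and>
     (\<forall>C\<in>\<A>. \<forall>z\<in>snd C ` (fst C \<inter> W). \<forall>j k l.
        wirtinger l (\<lambda>y. g C (chart_inv C y) $ j $ k) z =
        wirtinger j (\<lambda>y. g C (chart_inv C y) $ l $ k) z)"

definition weakly_pseudoconvex_kaehler ::
  "('a::topological_space, 'n::finite) chart set \<Rightarrow> 'a set \<Rightarrow> bool" where
  "weakly_pseudoconvex_kaehler \<A> W \<longleftrightarrow>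
     open W \<and> weakly_pseudoconvex \<A> W \<and> (\<exists>g. kaehler_metric \<A> W g)"


section \<open>Condition (A)\<close>

definition L2_sq :: "('a, 'n::finite) chart \<Rightarrow> 'a set \<Rightarrow> ('a \<Rightarrow> complex) \<Rightarrow> ennreal" where
  "L2_sq C D g =
     (\<integral>\<^sup>+ z. ennreal ((cmod (g (chart_inv C z)))\<^sup>2) * indicator (snd C ` D) z \<partial>lebesgue)"

definition L2_negligible ::
  "('a::topological_space, 'n::finite) chart set \<Rightarrow> 'a set \<Rightarrow> bool" where
  "L2_negligible \<A> X \<longleftrightarrow>
     (\<forall>C\<in>\<A>. \<forall>g. mfd_holo \<A> (fst C - X) g \<and> L2_sq C (fst C - X) g < \<infinity> \<longrightarrow>
        (\<exists>g'. mfd_holo \<A> (fst C) g' \<and> (\<forall>x\<in>fst C - X. g' x = g x) \<and>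
              L2_sq C (fst C) g' = L2_sq C (fst C - X) g))"

definition condition_A ::
  "('a::{t2_space, second_countable_topology}, 'n::finite) chart set \<Rightarrow> 'a set \<Rightarrow> 'a set \<Rightarrow> bool" where
  "condition_A \<A> X Z \<longleftrightarrow> complex_manifold \<A> \<and>
     closed X \<and> L2_negligible \<A> X \<and>
     analytic_subset \<A> Z \<and> weakly_pseudoconvex_kaehler \<A> (- (X \<union> Z))"


section \<open>Germs and multiplier ideals\<close>

text \<open>Germs are equivalence classes of total functions; only values near the point matter.\<close>

definition germ :: "'a::topological_space \<Rightarrow> ('a \<Rightarrow> complex) \<Rightarrow> ('a \<Rightarrow> complex) set" where
  "germ z g = {h. eventually (\<lambda>x. h x = g x) (nhds z)}"

definition stalk ::
  "('a::topological_space, 'n::finite) chart set \<Rightarrow> 'a \<Rightarrow> ('a \<Rightarrow> complex) set ring" where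
  "stalk \<A> z =
     \<lparr> carrier = {germ z g | g W. z \<in> W \<and> mfd_holo \<A> W g},
       monoid.mult = (\<lambda>a b. {h. \<exists>f\<in>a. \<exists>g\<in>b. eventually (\<lambda>x. h x = f x * g x) (nhds z)}),
       one = germ z (\<lambda>_. 1),
       zero = germ z (\<lambda>_. 0),
       add = (\<lambda>a b. {h. \<exists>f\<in>a. \<exists>g\<in>b. eventually (\<lambda>x. h x = f x + g x) (nhds z)}) \<rparr>"

text \<open>
  On a complex manifold the stalks are commutative rings, so that \<^const>\<open>ideal\<close>, which
  includes the ring axioms, has its usual meaning for them.
\<close>

lemma holo_fun_const: "open S \<Longrightarrow> holo_fun (\<lambda>_. k) S"
  unfolding holo_fun_def by (auto intro!: exI[of _ "\<lambda>_. 0"])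

lemma holo_fun_add: "holo_fun f S \<Longrightarrow> holo_fun g S \<Longrightarrow> holo_fun (\<lambda>x. f x + g x) S"
  unfolding holo_fun_def
proof (intro conjI ballI, blast)
  fix z assume A: "open S \<and> (\<forall>z\<in>S. \<exists>L. (f has_derivative L) (at z) \<and> (\<forall>c v. L (c *s v) = c * L v))"
    "open S \<and> (\<forall>z\<in>S. \<exists>L. (g has_derivative L) (at z) \<and> (\<forall>c v. L (c *s v) = c * L v))" "z \<in> S"
  then obtain L M where "(f has_derivative L) (at z)" "\<forall>c v. L (c *s v) = c * L v"
    "(g has_derivative M) (at z)" "\<forall>c v. M (c *s v) = c * M v" by blast
  then show "\<exists>L. ((\<lambda>x. f x + g x) has_derivative L) (at z) \<and> (\<forall>c v. L (c *s v) = c * L v)"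
    by (intro exI[of _ "\<lambda>x. L x + M x"]) (auto intro: has_derivative_add simp: algebra_simps)
qed

lemma holo_fun_mult: "holo_fun f S \<Longrightarrow> holo_fun g S \<Longrightarrow> holo_fun (\<lambda>x. f x * g x) S"
  unfolding holo_fun_def
proof (intro conjI ballI, blast)
  fix z assume A: "open S \<and> (\<forall>z\<in>S. \<exists>L. (f has_derivative L) (at z) \<and> (\<forall>c v. L (c *s v) = c * L v))"
    "open S \<and> (\<forall>z\<in>S. \<exists>L. (g has_derivative L) (at z) \<and> (\<forall>c v. L (c *s v) = c * L v))" "z \<in> S"
  then obtain L M where "(f has_derivative L) (at z)" "\<forall>c v. L (c *s v) = c * L v"
    "(g has_derivative M) (at z)" "\<forall>c v. M (c *s v) = c * M v" by blast
  then show "\<exists>L. ((\<lambda>x. f x * g x) has_derivative L) (at z) \<and> (\<forall>c v. L (c *s v) = c * L v)"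
    by (intro exI[of _ "\<lambda>x. f z * M x + L x * g z"] conjI has_derivative_mult)
      (simp_all add: algebra_simps)
qed

lemma open_chart_image:
  assumes "is_chart C" "open W" shows "open (snd C ` (fst C \<inter> W))"
proof -
  have *: "homeomorphism (fst C) (snd C ` fst C) (snd C) (chart_inv C)"
     "open (fst C)" "open (snd C ` fst C)" using assms(1) by (auto simp: is_chart_def)
  then have "openin (top_of_set (snd C ` fst C)) (snd C ` (fst C \<inter> W))"
    by (intro homeomorphism_imp_open_map[OF *(1)] openin_open_Int assms(2))
  then show ?thesis by (rule openin_open_trans) (rule *(3))
qed

lemma mfd_holo_const: "complex_manifold \<A> \<Longrightarrow> open W \<Longrightarrow> mfd_holo \<A> W (\<lambda>_. k)"
  unfolding mfd_holo_def o_def complex_manifold_def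
  by (intro conjI ballI holo_fun_const open_chart_image) blast+

lemma holo_fun_subset: "holo_fun f S \<Longrightarrow> open S' \<Longrightarrow> S' \<subseteq> S \<Longrightarrow> holo_fun f S'"
  by (auto simp: holo_fun_def)

lemma mfd_holo_subset:
  assumes A: "complex_manifold \<A>" and g: "mfd_holo \<A> W g" and W': "open W'" "W' \<subseteq> W"
  shows "mfd_holo \<A> W' g"
  unfolding mfd_holo_def
proof (intro conjI ballI)
  fix C assume C: "C \<in> \<A>"
  show "holo_fun (g \<circ> chart_inv C) (snd C ` (fst C \<inter> W'))"
  proof (rule holo_fun_subset)
    show "holo_fun (g \<circ> chart_inv C) (snd C ` (fst C \<inter> W))" using g C unfolding mfd_holo_def by blast
    show "open (snd C ` (fst C \<inter> W'))"
      by (rule open_chart_image) (use A C W' in \<open>simp_all add: complex_manifold_def\<close>)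
    show "snd C ` (fst C \<inter> W') \<subseteq> snd C ` (fst C \<inter> W)" using W' by blast
  qed
qed (rule W')

lemma mfd_holo_add:
  assumes "mfd_holo \<A> W f" "mfd_holo \<A> W g"
  shows "mfd_holo \<A> W (\<lambda>x. f x + g x)"
  unfolding mfd_holo_def o_def
proof (intro conjI ballI)
  fix C assume C: "C \<in> \<A>"
  show "holo_fun (\<lambda>x. f (chart_inv C x) + g (chart_inv C x)) (snd C ` (fst C \<inter> W))"
    by (rule holo_fun_add) (use assms C in \<open>simp_all add: mfd_holo_def o_def\<close>)
qed (use assms in \<open>simp add: mfd_holo_def\<close>)

lemma mfd_holo_mult:
  assumes "mfd_holo \<A> W f" "mfd_holo \<A> W g"
  shows "mfd_holo \<A> W (\<lambda>x. f x * g x)"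
  unfolding mfd_holo_def o_def
proof (intro conjI ballI)
  fix C assume C: "C \<in> \<A>"
  show "holo_fun (\<lambda>x. f (chart_inv C x) * g (chart_inv C x)) (snd C ` (fst C \<inter> W))"
    by (rule holo_fun_mult) (use assms C in \<open>simp_all add: mfd_holo_def o_def\<close>)
qed (use assms in \<open>simp add: mfd_holo_def\<close>)

lemma germ_refl: "g \<in> germ z g" by (simp add: germ_def)

lemma stalk_mult_germ: "germ z f \<otimes>\<^bsub>stalk \<A> z\<^esub> germ z g = germ z (\<lambda>x. f x * g x)"
proof -
  have 1: "h \<in> germ z (\<lambda>x. f x * g x)" if "f' \<in> germ z f" "g' \<in> germ z g"
    "eventually (\<lambda>x. h x = f' x * g' x) (nhds z)" for h f' g'
    using that unfolding germ_def mem_Collect_eq by eventually_elim simp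
  have 2: "\<exists>f'\<in>germ z f. \<exists>g'\<in>germ z g. eventually (\<lambda>x. h x = f' x * g' x) (nhds z)"
    if "h \<in> germ z (\<lambda>x. f x * g x)" for h
  proof (intro bexI)
    show "eventually (\<lambda>x. h x = f x * g x) (nhds z)" using that unfolding germ_def mem_Collect_eq .
  qed (rule germ_refl)+
  have "{h. \<exists>f'\<in>germ z f. \<exists>g'\<in>germ z g. eventually (\<lambda>x. h x = f' x * g' x) (nhds z)}
      = germ z (\<lambda>x. f x * g x)"
  proof (rule equalityI; rule subsetI)
    fix h assume "h \<in> {h. \<exists>f'\<in>germ z f. \<exists>g'\<in>germ z g. eventually (\<lambda>x. h x = f' x * g' x) (nhds z)}"
    then show "h \<in> germ z (\<lambda>x. f x * g x)"
      unfolding mem_Collect_eq by (elim bexE) (rule 1)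
  next
    fix h assume "h \<in> germ z (\<lambda>x. f x * g x)"
    from 2[OF this] show "h \<in> {h. \<exists>f'\<in>germ z f. \<exists>g'\<in>germ z g. eventually (\<lambda>x. h x = f' x * g' x) (nhds z)}"
      unfolding mem_Collect_eq .
  qed
  then show ?thesis unfolding stalk_def by simp
qed
lemma stalk_add_germ: "germ z f \<oplus>\<^bsub>stalk \<A> z\<^esub> germ z g = germ z (\<lambda>x. f x + g x)"
proof -
  have 1: "h \<in> germ z (\<lambda>x. f x + g x)" if "f' \<in> germ z f" "g' \<in> germ z g"
    "eventually (\<lambda>x. h x = f' x + g' x) (nhds z)" for h f' g'
    using that unfolding germ_def mem_Collect_eq by eventually_elim simp
  have 2: "\<exists>f'\<in>germ z f. \<exists>g'\<in>germ z g. eventually (\<lambda>x. h x = f' x + g' x) (nhds z)"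
    if "h \<in> germ z (\<lambda>x. f x + g x)" for h
  proof (intro bexI)
    show "eventually (\<lambda>x. h x = f x + g x) (nhds z)" using that unfolding germ_def mem_Collect_eq .
  qed (rule germ_refl)+
  have "{h. \<exists>f'\<in>germ z f. \<exists>g'\<in>germ z g. eventually (\<lambda>x. h x = f' x + g' x) (nhds z)}
      = germ z (\<lambda>x. f x + g x)"
  proof (rule equalityI; rule subsetI)
    fix h assume "h \<in> {h. \<exists>f'\<in>germ z f. \<exists>g'\<in>germ z g. eventually (\<lambda>x. h x = f' x + g' x) (nhds z)}"
    then show "h \<in> germ z (\<lambda>x. f x + g x)"
      unfolding mem_Collect_eq by (elim bexE) (rule 1)
  next
    fix h assume "h \<in> germ z (\<lambda>x. f x + g x)"
    from 2[OF this] show "h \<in> {h. \<exists>f'\<in>germ z f. \<exists>g'\<in>germ z g. eventually (\<lambda>x. h x = f' x + g' x) (nhds z)}"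
      unfolding mem_Collect_eq .
  qed
  then show ?thesis unfolding stalk_def by simp
qed

lemma stalk_carrierE:
  assumes "a \<in> carrier (stalk \<A> z)"
  obtains g W where "a = germ z g" "z \<in> W" "mfd_holo \<A> W g"
  using assms by (auto simp: stalk_def)

lemma stalk_carrierI: "z \<in> W \<Longrightarrow> mfd_holo \<A> W g \<Longrightarrow> germ z g \<in> carrier (stalk \<A> z)"
  by (auto simp: stalk_def)

lemma stalk_common:
  assumes "complex_manifold \<A>" "z \<in> W" "mfd_holo \<A> W g" "z \<in> V" "mfd_holo \<A> V h"
  shows "z \<in> W \<inter> V" "mfd_holo \<A> (W \<inter> V) g" "mfd_holo \<A> (W \<inter> V) h"
proof -
  have "open (W \<inter> V)" using assms by (auto simp: mfd_holo_def)
  then show "mfd_holo \<A> (W \<inter> V) g" "mfd_holo \<A> (W \<inter> V) h"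
    using assms mfd_holo_subset by (metis inf_le1, metis inf_le2)
qed (use assms in auto)

lemma stalk_cring:
  assumes A: "complex_manifold \<A>" shows "cring (stalk \<A> z)"
proof -
  have one: "\<one>\<^bsub>stalk \<A> z\<^esub> = germ z (\<lambda>_. 1)" and zero: "\<zero>\<^bsub>stalk \<A> z\<^esub> = germ z (\<lambda>_. 0)" by (auto simp: stalk_def)
  have cst: "germ z (\<lambda>_. k) \<in> carrier (stalk \<A> z)" for k
    by (rule stalk_carrierI[of _ UNIV]) (auto intro: mfd_holo_const A)
  have clm: "a \<otimes>\<^bsub>stalk \<A> z\<^esub> b \<in> carrier (stalk \<A> z)"
    and cla: "a \<oplus>\<^bsub>stalk \<A> z\<^esub> b \<in> carrier (stalk \<A> z)"
    if ab: "a \<in> carrier (stalk \<A> z)" "b \<in> carrier (stalk \<A> z)" for a b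
  proof -
    obtain g W h V where 1: "a = germ z g" "z \<in> W" "mfd_holo \<A> W g" "b = germ z h" "z \<in> V" "mfd_holo \<A> V h"
      using ab by (metis stalk_carrierE)
    note 2 = stalk_common[OF A 1(2,3,5,6)]
    show "a \<otimes>\<^bsub>stalk \<A> z\<^esub> b \<in> carrier (stalk \<A> z)" "a \<oplus>\<^bsub>stalk \<A> z\<^esub> b \<in> carrier (stalk \<A> z)"
      unfolding 1(1,4) stalk_mult_germ stalk_add_germ
      using stalk_carrierI[OF 2(1) mfd_holo_mult[OF 2(2,3)]] stalk_carrierI[OF 2(1) mfd_holo_add[OF 2(2,3)]] by auto
  qed
  show ?thesis
  proof (intro cringI abelian_groupI comm_monoidI)
    fix a assume a: "a \<in> carrier (stalk \<A> z)"
    then obtain g W where 1: "a = germ z g" "z \<in> W" "mfd_holo \<A> W g" by (rule stalk_carrierE)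
    have "open W" using 1 by (auto simp: mfd_holo_def)
    have "germ z (\<lambda>x. (-1) * g x) \<in> carrier (stalk \<A> z)"
      using stalk_carrierI[OF 1(2) mfd_holo_mult[OF mfd_holo_const[OF A \<open>open W\<close>] 1(3)]] .
    moreover have "germ z (\<lambda>x. (-1) * g x) \<oplus>\<^bsub>stalk \<A> z\<^esub> a = \<zero>\<^bsub>stalk \<A> z\<^esub>"
      by (simp add: 1 stalk_add_germ zero)
    ultimately show "\<exists>y\<in>carrier (stalk \<A> z). y \<oplus>\<^bsub>stalk \<A> z\<^esub> a = \<zero>\<^bsub>stalk \<A> z\<^esub>" by blast
  qed (auto simp: one zero cst clm cla elim!: stalk_carrierE simp: stalk_mult_germ stalk_add_germ algebra_simps)
qed

fun exp_neg :: "ereal \<Rightarrow> ennreal" where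
  "exp_neg (ereal r) = ennreal (exp (- r))"
| "exp_neg PInfty = 0"
| "exp_neg MInfty = \<infinity>"

definition multiplier_ideal ::
  "('a::topological_space, 'n::finite) chart set \<Rightarrow> ('a \<Rightarrow> ereal) \<Rightarrow> 'a \<Rightarrow> ('a \<Rightarrow> complex) set set" where
  "multiplier_ideal \<A> \<Phi> z =
     {germ z g | g W. z \<in> W \<and> mfd_holo \<A> W g \<and>
        (\<exists>C\<in>\<A>. \<exists>N. open N \<and> z \<in> N \<and> N \<subseteq> fst C \<inter> W \<and>
           (\<integral>\<^sup>+ w. ennreal ((cmod (g (chart_inv C w)))\<^sup>2) * exp_neg (\<Phi> (chart_inv C w))
                * indicator (snd C ` N) w \<partial>lebesgue) < \<infinity>)}"

text \<open>The support of the quotient sheaf of the structure sheaf by the multiplier ideal sheaf.\<close>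

definition multiplier_support ::
  "('a::topological_space, 'n::finite) chart set \<Rightarrow> ('a \<Rightarrow> ereal) \<Rightarrow> 'a set" where
  "multiplier_support \<A> \<Phi> = {z. multiplier_ideal \<A> \<Phi> z \<noteq> carrier (stalk \<A> z)}"


section \<open>Holomorphic (n,0) forms and their integrals\<close>

text \<open>
  A form is a partial function whose domain is the set on which it is defined.  Its value at
  \<open>p\<close> is an element of the fibre of the canonical bundle, represented by the family of its
  coefficients with respect to \<open>dz\<^sub>1 \<and> \<dots> \<and> dz\<^sub>n\<close> in all charts around \<open>p\<close>
  (the coefficients at other index pairs are normalised to 0).
\<close>

type_synonym ('a, 'n) form = "'a \<rightharpoonup> (('a, 'n) chart \<Rightarrow> complex)"

definition coef :: "('a, 'n) form \<Rightarrow> ('a, 'n) chart \<Rightarrow> 'a \<Rightarrow> complex" where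
  "coef F C p = the (F p) C"

definition holo_forms ::
  "('a::topological_space, 'n::finite) chart set \<Rightarrow> 'a set \<Rightarrow> ('a, 'n) form set" where
  "holo_forms \<A> W = {F. open W \<and> dom F = W \<and>
     (\<forall>p\<in>W. \<forall>C. C \<notin> \<A> \<or> p \<notin> fst C \<longrightarrow> coef F C p = 0) \<and>
     (\<forall>C\<in>\<A>. \<forall>D\<in>\<A>. \<forall>p\<in>W \<inter> fst C \<inter> fst D.
        coef F C p = coef F D p * det (complex_jacobian (transition C D) (snd C p))) \<and>
     (\<forall>C\<in>\<A>. holo_fun (coef F C \<circ> chart_inv C) (snd C ` (fst C \<inter> W)))}"

text \<open>\<open>F - f\<close> is a section over \<open>Z0\<close> of the canonical sheaf tensored with the ideals \<open>\<F>\<close>.\<close>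

definition diff_in ::
  "('a::topological_space, 'n::finite) chart set \<Rightarrow> ('a, 'n) form \<Rightarrow> ('a, 'n) form \<Rightarrow> 'a set \<Rightarrow>
   ('a \<Rightarrow> ('a \<Rightarrow> complex) set set) \<Rightarrow> bool" where
  "diff_in \<A> F f Z0 \<F> \<longleftrightarrow>
     (\<forall>z\<in>Z0. \<forall>C\<in>\<A>. z \<in> fst C \<longrightarrow> germ z (\<lambda>p. coef F C p - coef f C p) \<in> \<F> z)"

text \<open>
  Integration over the manifold is reduced to the charts by means of a countable Borel
  partition subordinate to the atlas; by the change of variables formula the value of the
  integral does not depend on the chosen partition.  In coordinates
  \<open>\<i>\<^bsup>n\<^sup>2\<^esup> F \<and> cnj F = 2\<^sup>n |F\<^sub>C|\<^sup>2 d\<lambda>\<close>, where \<open>F\<^sub>C\<close> is the coefficient and \<open>\<lambda>\<close> is Lebesgue measure.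
\<close>

definition chart_partition ::
  "('a::topological_space, 'n::finite) chart set \<Rightarrow> (nat \<Rightarrow> ('a, 'n) chart \<times> 'a set) \<Rightarrow> bool" where
  "chart_partition \<A> P \<longleftrightarrow>
     (\<forall>i. fst (P i) \<in> \<A> \<and> snd (P i) \<in> sets borel \<and> snd (P i) \<subseteq> fst (fst (P i))) \<and>
     disjoint_family (\<lambda>i. snd (P i)) \<and> (\<Union>i. snd (P i)) = UNIV"

lemma chart_partition_exists:
  assumes A: "complex_manifold \<A>"
  shows "\<exists>P. chart_partition \<A> P"
proof -
  have op: "open U" if "U \<in> fst ` \<A>" for U
    using A that by (auto simp: complex_manifold_def is_chart_def)
  obtain \<U> where U: "\<U> \<subseteq> fst ` \<A>" "countable \<U>" "\<Union>\<U> = \<Union>(fst ` \<A>)"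
    using Lindelof[of "fst ` \<A>"] op by blast
  have cover: "\<Union>\<U> = UNIV" using U(3) A by (auto simp: complex_manifold_def)
  then have ne: "\<U> \<noteq> {}" by auto
  define V where "V = from_nat_into \<U>"
  have V: "range V = \<U>" using ne U(2) by (simp add: V_def)
  have "\<forall>i. \<exists>C\<in>\<A>. fst C = V i" using V U(1) by (metis imageE rangeI subsetD)
  then obtain C where C: "\<And>i. C i \<in> \<A>" "\<And>i. fst (C i) = V i" by metis
  have "V i \<in> sets borel" for i using op C by (metis borel_open imageI)
  then have "disjointed V i \<in> sets borel" for i
    by (auto simp: disjointed_def)
  then have "chart_partition \<A> (\<lambda>i. (C i, disjointed V i))"
    using C cover V
    by (auto simp: chart_partition_def disjoint_family_disjointed UN_disjointed_eq
        intro: subsetD[OF disjointed_subset])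
  then show ?thesis by blast
qed

definition chart_integral ::
  "('a, 'n::finite) chart \<Rightarrow> 'a set \<Rightarrow> ('a, 'n) form \<Rightarrow> ('a \<Rightarrow> ennreal) \<Rightarrow> ennreal" where
  "chart_integral C B F w =
     (\<integral>\<^sup>+ z. ennreal (2 ^ CARD('n) * (cmod (coef F C (chart_inv C z)))\<^sup>2) * w (chart_inv C z)
          * indicator (snd C ` B) z \<partial>lebesgue)"

text \<open>The integral of \<open>|F|\<^sup>2 w\<close> over \<open>D\<close>.\<close>

definition form_integral ::
  "('a::topological_space, 'n::finite) chart set \<Rightarrow> 'a set \<Rightarrow> ('a, 'n) form \<Rightarrow> ('a \<Rightarrow> ennreal) \<Rightarrow> ennreal" where
  "form_integral \<A> D F w =
     (let P = (SOME P. chart_partition \<A> P)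
      in \<Sum>i. chart_integral (fst (P i)) (snd (P i) \<inter> D) F w)"


section \<open>Minimal L2 integrals\<close>

text \<open>The open sublevel set \<open>{\<psi> < -t}\<close>.\<close>

definition sublevel :: "('a \<Rightarrow> ereal) \<Rightarrow> real \<Rightarrow> 'a set" where
  "sublevel \<psi> t = {x. \<psi> x < ereal (- t)}"

text \<open>
  The weight \<open>e\<^bsup>-\<phi>\<^esup> c(-\<psi>)\<close>.  On the null set where \<open>\<psi> = -\<infinity>\<close> the expression \<open>c(-\<psi>)\<close> has
  no meaning; the value 0 there is a convention that does not affect integrals.
\<close>

definition weight :: "('a \<Rightarrow> ereal) \<Rightarrow> ('a \<Rightarrow> ereal) \<Rightarrow> (real \<Rightarrow> real) \<Rightarrow> 'a \<Rightarrow> ennreal" where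
  "weight \<phi> \<psi> c x =
     (if \<psi> x = -\<infinity> then 0 else exp_neg (\<phi> x) * ennreal (c (- real_of_ereal (\<psi> x))))"

definition gain_class ::
  "real \<Rightarrow> 'a::topological_space set \<Rightarrow> ('a \<Rightarrow> ereal) \<Rightarrow> ('a \<Rightarrow> ereal) \<Rightarrow> (real \<Rightarrow> real) set" where
  "gain_class T Z \<phi> \<psi> =
     {c. (\<forall>t>T. 0 < c t) \<and> c \<in> borel_measurable (lebesgue_on {T<..}) \<and>
         antimono_on {T<..} (\<lambda>t. c t * exp (- t)) \<and>
         (\<exists>E. closed E \<and> E \<subseteq> Z \<inter> {x. \<psi> x = -\<infinity>} \<and>
            (\<forall>K. compact K \<and> K \<inter> E = {} \<longrightarrow>
               (\<exists>\<epsilon>>0. \<forall>x\<in>K. \<psi> x \<noteq> -\<infinity> \<longrightarrow> ennreal \<epsilon> \<le> weight \<phi> \<psi> c x)))}"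

definition admissible_data ::
  "('a::topological_space, 'n::finite) chart set \<Rightarrow> ('a \<Rightarrow> ereal) \<Rightarrow> ('a \<Rightarrow> ereal) \<Rightarrow> 'a set \<Rightarrow>
   ('a \<Rightarrow> ('a \<Rightarrow> complex) set set) \<Rightarrow> bool" where
  "admissible_data \<A> \<phi> \<psi> Z0 \<F> \<longleftrightarrow>
     Z0 \<subseteq> {x. \<psi> x = -\<infinity>} \<and>
     Z0 \<inter> multiplier_support \<A> (\<lambda>x. \<phi> x + \<psi> x) \<noteq> {} \<and>
     (\<forall>z\<in>Z0. ideal (\<F> z) (stalk \<A> z) \<and> multiplier_ideal \<A> (\<lambda>x. \<phi> x + \<psi> x) z \<subseteq> \<F> z)"

definition H2 ::
  "('a::topological_space, 'n::finite) chart set \<Rightarrow> ('a, 'n) form \<Rightarrow> 'a set \<Rightarrow>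
   ('a \<Rightarrow> ('a \<Rightarrow> complex) set set) \<Rightarrow> (real \<Rightarrow> real) \<Rightarrow> real \<Rightarrow> ('a \<Rightarrow> ereal) \<Rightarrow> ('a \<Rightarrow> ereal) \<Rightarrow>
   ('a, 'n) form set" where
  "H2 \<A> f Z0 \<F> c t \<phi> \<psi> =
     {F \<in> holo_forms \<A> (sublevel \<psi> t).
        form_integral \<A> (sublevel \<psi> t) F (weight \<phi> \<psi> c) < \<infinity> \<and> diff_in \<A> F f Z0 \<F>}"

definition min_L2 ::
  "('a::topological_space, 'n::finite) chart set \<Rightarrow> ('a, 'n) form \<Rightarrow> 'a set \<Rightarrow>
   ('a \<Rightarrow> ('a \<Rightarrow> complex) set set) \<Rightarrow> real \<Rightarrow> ('a \<Rightarrow> ereal) \<Rightarrow> ('a \<Rightarrow> ereal) \<Rightarrow> (real \<Rightarrow> real) \<Rightarrow>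
   ennreal" where
  "min_L2 \<A> f Z0 \<F> t \<phi> \<psi> c =
     (INF F \<in> {F \<in> holo_forms \<A> (sublevel \<psi> t). diff_in \<A> F f Z0 \<F>}.
        form_integral \<A> (sublevel \<psi> t) F (weight \<phi> \<psi> c))"

definition gain_tail :: "(real \<Rightarrow> real) \<Rightarrow> real \<Rightarrow> ennreal" where
  "gain_tail c t = (\<integral>\<^sup>+ l. ennreal (c l * exp (- l)) * indicator {t<..} l \<partial>lebesgue)"

text \<open>
  Linearity on \<open>[a, b]\<close> refers to real arguments: if \<open>b = \<infinity>\<close>, the interval is \<open>[a, \<infinity>)\<close>.
  Values are finite, being equal to real numbers.
\<close>

definition linear_between :: "(ennreal \<Rightarrow> ennreal) \<Rightarrow> ennreal \<Rightarrow> ennreal \<Rightarrow> bool" where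
  "linear_between u a b \<longleftrightarrow>
     (\<exists>\<alpha> \<beta> :: real. \<forall>r\<ge>0. a \<le> ennreal r \<and> ennreal r \<le> b \<longrightarrow>
        enn2ereal (u (ennreal r)) = ereal (\<alpha> * r + \<beta>))"

end

theory Submission
  imports Defs
begin

text \<open>
  Linearity of \<open>G(h'\<^sup>-\<^sup>1(r); \<phi>', \<psi>', c')\<close> with slope \<open>\<alpha>\<close> says that the integral of
  \<open>|F'|\<^sup>2 e\<^bsup>-\<phi>'\<^esup> c'(-\<psi>')\<close> over the shell \<open>{-T\<^sub>2 \<le> \<psi>' < -t}\<close> is \<open>\<alpha>\<close> times the integral of
  \<open>c'(s) e\<^bsup>-s\<^esup>\<close> over \<open>(t, T\<^sub>2]\<close>, for all \<open>t\<close> between \<open>T\<^sub>1\<close> and \<open>T\<^sub>2\<close>.  Half-open intervals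
  determine a measure, so the image of \<open>|F'|\<^sup>2 e\<^bsup>-\<phi>'\<^esup>\<close> under \<open>-\<psi>'\<close> is \<open>\<alpha> e\<^bsup>-s\<^esup> ds\<close> on
  \<open>(T\<^sub>1, T\<^sub>2]\<close>, and the gain \<open>c'\<close> may be exchanged for \<open>c\<close> (\<open>energy_shell_of_linear\<close>).  On
  \<open>{-T\<^sub>2 \<le> \<psi> < -T\<^sub>1}\<close> the two pairs of weights agree, and on \<open>{\<psi> < -T\<^sub>2}\<close> the form \<open>F'\<close> is
  minimal for \<open>c\<close>.  Hence the integral of \<open>|F'|\<^sup>2 e\<^bsup>-\<phi>\<^esup> c(-\<psi>)\<close> over \<open>{\<psi> < -t}\<close> is
  \<open>G(T\<^sub>2) + \<alpha> (h(t) - h(T\<^sub>2))\<close>, which is linear in \<open>h(t)\<close>.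

  It remains to see that this value is \<open>G(t; \<phi>, \<psi>, c)\<close>, i.e. that \<open>F'\<close> is also minimal for \<open>c\<close> on
  \<open>{\<psi> < -t}\<close>.  Let \<open>F\<close> be a competitor with finite integral.  The assumed inclusion of the spaces
  \<open>H2\<close> makes it a competitor with finite integral for \<open>c'\<close>, so for every \<open>s\<close> in \<open>[t, T\<^sub>2]\<close> and every real \<open>r\<close> the form
  \<open>F' + r (F - F')\<close> competes with the minimal form \<open>F'\<close> on \<open>{\<psi>' < -s}\<close>.  Therefore \<open>F - F'\<close> is
  orthogonal to \<open>F'\<close> there (for the real part of the inner product), hence on every shell \<open>{-T\<^sub>2 \<le> \<psi>' < -s}\<close>, and again the vanishing of
  these cross terms for all \<open>s\<close> is independent of the gain (\<open>energy_shell_le_if_minimal\<close>).  So for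
  \<open>c\<close> the form \<open>F\<close> costs at least as much as \<open>F'\<close> on the shell, and on \<open>{\<psi> < -T\<^sub>2}\<close> it costs at
  least \<open>G(T\<^sub>2)\<close>.

  The inclusion of the spaces \<open>H2\<close> enters in a second way: a form determines the set on which it is defined, so that
  an element common to both spaces forces \<open>{\<psi> < -t} = {\<psi>' < -t}\<close>.
\<close>

section \<open>Tails of the gain and measures on an interval\<close>

text \<open>
  A gain is only controlled above \<open>T\<close>.  There it is a monotone function times the exponential,
  so that its extension by 0 is Borel on the whole line.  The weights contain \<open>c(-\<psi>)\<close>, whose
  measurability would not follow from Lebesgue measurability of \<open>c\<close>.
\<close>
definition trunc :: "real \<Rightarrow> (real \<Rightarrow> real) \<Rightarrow> real \<Rightarrow> real" where
  "trunc T c t = (if T < t then c t else 0)"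

lemma borel_measurable_trunc:
  assumes "antimono_on {T<..} (\<lambda>t. c t * exp (- t))"
  shows "trunc T c \<in> borel_measurable borel"
proof -
  have "mono_on {T<..} (\<lambda>t. - (c t * exp (- t)))"
    using assms by (auto simp: monotone_on_def)
  then have "(\<lambda>t. - (c t * exp (- t))) \<in> borel_measurable (restrict_space borel {T<..})"
    by (rule borel_measurable_mono_on_fnc)
  then have "(\<lambda>t. (- (c t * exp (- t))) * (- exp t)) \<in> borel_measurable (restrict_space borel {T<..})"
    by (rule borel_measurable_times) (rule measurable_restrict_space1, measurable)
  then have "c \<in> borel_measurable (restrict_space borel {T<..})"
    by (simp add: exp_minus mult.assoc)
  then have "(\<lambda>t. if t \<in> {T<..} then c t else 0) \<in> borel_measurable borel"
    by (subst (asm) measurable_restrict_space_iff[where c=0 and f=c]) auto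
  then show ?thesis by (simp add: trunc_def[abs_def])
qed

locale gain =
  fixes T :: real and c :: "real \<Rightarrow> real"
  assumes pos: "T < t \<Longrightarrow> 0 < c t"
    and anti: "antimono_on {T<..} (\<lambda>t. c t * exp (- t))"
begin

definition gain_between :: "real \<Rightarrow> real \<Rightarrow> ennreal" where
  "gain_between s t = (\<integral>\<^sup>+ l. ennreal (c l * exp (- l)) * indicator {s<..t} l \<partial>lborel)"

lemma meas [measurable]: "trunc T c \<in> borel_measurable borel"
  by (rule borel_measurable_trunc[OF anti])

lemma tail_eq: "T \<le> t \<Longrightarrow> gain_tail c t = (\<integral>\<^sup>+ l. ennreal (trunc T c l * exp (- l)) * indicator {t<..} l \<partial>lborel)"
  unfolding gain_tail_def nn_integral_completion
  by (intro nn_integral_cong) (auto simp: trunc_def indicator_def)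

lemma gain_between_eq: "T \<le> s \<Longrightarrow> gain_between s t = (\<integral>\<^sup>+ l. ennreal (trunc T c l * exp (- l)) * indicator {s<..t} l \<partial>lborel)"
  unfolding gain_between_def
  by (intro nn_integral_cong) (auto simp: trunc_def indicator_def)

lemma scaled_gain_between_eq:
  assumes "T \<le> s" "0 \<le> \<alpha>"
  shows "ennreal \<alpha> * gain_between s t
    = (\<integral>\<^sup>+ l. ennreal (trunc T c l) * ennreal (\<alpha> * exp (- l)) * indicator {s<..t} l \<partial>lborel)"
proof -
  have "ennreal \<alpha> * (ennreal (trunc T c l * exp (- l)) * i)
      = ennreal (trunc T c l) * ennreal (\<alpha> * exp (- l)) * i" for l i
    using assms(2) by (simp add: ennreal_mult' ennreal_mult'' ac_simps)
  then show ?thesis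
    unfolding gain_between_eq[OF assms(1)] by (subst nn_integral_cmult[symmetric]) auto
qed

lemma tail_split:
  assumes "T \<le> s" "s \<le> t"
  shows "gain_tail c s = gain_between s t + gain_tail c t"
proof -
  have "gain_tail c s = (\<integral>\<^sup>+ l. ennreal (trunc T c l * exp (- l)) * indicator {s<..t} l
      + ennreal (trunc T c l * exp (- l)) * indicator {t<..} l \<partial>lborel)"
    unfolding tail_eq[OF assms(1)]
    by (intro nn_integral_cong) (use assms in \<open>auto simp: indicator_def\<close>)
  also have "\<dots> = gain_between s t + gain_tail c t"
    using assms by (subst nn_integral_add) (auto simp: gain_between_eq tail_eq)
  finally show ?thesis .
qed

lemma density_antimono: "T < s \<Longrightarrow> s \<le> t \<Longrightarrow> c t * exp (- t) \<le> c s * exp (- s)"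
  using anti by (auto simp: monotone_on_def)

lemma gain_between_upper:
  assumes "T < s" "s \<le> t"
  shows "gain_between s t \<le> ennreal (c s * exp (- s) * (t - s))"
proof -
  have "gain_between s t \<le> (\<integral>\<^sup>+ l. ennreal (c s * exp (- s)) * indicator {s<..t} l \<partial>lborel)"
    unfolding gain_between_def
    by (intro nn_integral_mono)
      (use assms in \<open>auto simp: indicator_def intro!: ennreal_leI density_antimono\<close>)
  also have "\<dots> = ennreal (c s * exp (- s) * (t - s))"
    using assms pos[of s] by (simp add: nn_integral_cmult_indicator ennreal_mult')
  finally show ?thesis .
qed

lemma gain_between_lower:
  assumes "T \<le> s" "s \<le> t" "T < t"
  shows "ennreal (c t * exp (- t) * (t - s)) \<le> gain_between s t"
proof -
  have "ennreal (c t * exp (- t) * (t - s)) = (\<integral>\<^sup>+ l. ennreal (c t * exp (- t)) * indicator {s<..t} l \<partial>lborel)"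
    using assms pos[of t] by (simp add: nn_integral_cmult_indicator ennreal_mult')
  also have "\<dots> \<le> gain_between s t"
    unfolding gain_between_def
    by (intro nn_integral_mono)
      (use assms in \<open>auto simp: indicator_def intro!: ennreal_leI density_antimono\<close>)
  finally show ?thesis .
qed

lemma tail_finite:
  assumes "gain_tail c t0 < \<infinity>" "T \<le> t0" "T < t"
  shows "gain_tail c t < \<infinity>"
proof (cases "t \<le> t0")
  case True
  have "gain_between t t0 < \<infinity>" using gain_between_upper[OF assms(3) True] by (auto simp: less_top[symmetric] top_unique)
  then show ?thesis using tail_split[of t t0] assms True by (auto simp: less_top[symmetric])
next
  case False
  then have "gain_tail c t \<le> gain_tail c t0" using tail_split[of t0 t] assms by auto
  then show ?thesis using assms(1) by (rule le_less_trans)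
qed

lemma tail_strict:
  assumes "gain_tail c t0 < \<infinity>" "T \<le> t0" "T \<le> s" "s < t"
  shows "gain_tail c t < gain_tail c s"
proof -
  have "0 < ennreal (c t * exp (- t) * (t - s))" using assms pos[of t] by auto
  also have "\<dots> \<le> gain_between s t" using assms by (intro gain_between_lower) auto
  finally have p: "0 < gain_between s t" .
  have fin: "gain_tail c t < \<infinity>" using assms by (intro tail_finite[OF assms(1,2)]) auto
  have "0 + gain_tail c t < gain_between s t + gain_tail c t"
    using p fin ennreal_add_left_cancel_less[of "gain_tail c t" 0 "gain_between s t"]
    by (simp add: add.commute)
  then show ?thesis using tail_split[of s t] assms by simp
qed

lemma inv_tail:
  assumes "gain_tail c t0 < \<infinity>" "T \<le> t0" "T \<le> t"
  shows "inv_into {T..} (gain_tail c) (gain_tail c t) = t"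
proof (rule inv_into_f_f)
  show "inj_on (gain_tail c) {T..}"
    by (rule linorder_inj_onI) (use tail_strict[OF assms(1,2)] in \<open>force+\<close>)
qed (use assms in auto)

text \<open>
  Right continuity of the tail, in a form that also covers an infinite tail at \<open>s = T\<close>.
\<close>
lemma tail_SUP:
  assumes "T \<le> s" "a < gain_tail c s"
  obtains s' where "s < s'" "a < gain_tail c s'"
proof -
  have "gain_tail c s = (\<integral>\<^sup>+ l. (SUP n. ennreal (trunc T c l * exp (- l)) * indicator {s + 1 / Suc n<..} l) \<partial>lborel)"
    unfolding tail_eq[OF assms(1)]
  proof (intro nn_integral_cong)
    fix l :: real
    show "ennreal (trunc T c l * exp (- l)) * indicator {s<..} l
       = (SUP n. ennreal (trunc T c l * exp (- l)) * indicator {s + 1 / Suc n<..} l)"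
    proof (cases "s < l")
      case True
      then obtain n where n: "1 / Suc n < l - s" using nat_approx_posE[of "l - s"] by auto
      show ?thesis
        by (rule antisym) (use True n in \<open>auto intro!: SUP_upper2[of n] SUP_least simp: indicator_def\<close>)
    next
      case False
      then have "\<not> s + 1 / Suc n < l" for n
        by (smt (verit) divide_nonneg_nonneg of_nat_0_le_iff)
      then show ?thesis using False by (simp add: indicator_def)
    qed
  qed
  also have "\<dots> = (SUP n. \<integral>\<^sup>+ l. ennreal (trunc T c l * exp (- l)) * indicator {s + 1 / Suc n<..} l \<partial>lborel)"
  proof (rule nn_integral_monotone_convergence_SUP)
    show "incseq (\<lambda>n l. ennreal (trunc T c l * exp (- l)) * indicator {s + 1 / Suc n<..} l)"
    proof (intro incseq_SucI le_funI mult_left_mono)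
      fix n and l :: real
      have "1 / real (Suc (Suc n)) \<le> 1 / real (Suc n)" by (simp add: frac_le)
      then show "(indicator {s + 1 / real (Suc n)<..} l :: ennreal) \<le> indicator {s + 1 / real (Suc (Suc n))<..} l"
        by (auto simp: indicator_def)
    qed auto
  qed auto
  also have "\<dots> = (SUP n. gain_tail c (s + 1 / Suc n))"
    using assms(1) by (intro SUP_cong) (auto simp: tail_eq add_increasing2)
  finally obtain n where "a < gain_tail c (s + 1 / Suc n)"
    using assms(2) by (auto simp: less_SUP_iff)
  then show ?thesis by (intro that[of "s + 1 / Suc n"]) auto
qed

lemma tail_real_diff:
  assumes "gain_tail c t < \<infinity>" "T \<le> s" "gain_tail c s < \<infinity>" "s \<le> t"
  shows "gain_between s t = ennreal (enn2real (gain_tail c s) - enn2real (gain_tail c t))"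
proof -
  obtain a where a: "gain_tail c s = ennreal a" "a \<ge> 0" using assms(3) by (cases "gain_tail c s") auto
  obtain b where b: "gain_tail c t = ennreal b" "b \<ge> 0" using assms(1) by (cases "gain_tail c t") auto
  have p: "gain_between s t + ennreal b = ennreal a" using tail_split[of s t] assms a b by simp
  then obtain d where d: "gain_between s t = ennreal d" "d \<ge> 0" by (cases "gain_between s t") auto
  have "d + b = a" using p a b d by (simp flip: ennreal_plus)
  then show ?thesis using a b d by simp
qed

text \<open>
  Away from \<open>T\<close> the monotone density \<open>c(l) e\<^bsup>-l\<^esup>\<close> is bounded, so the tail is Lipschitz there and
  takes all intermediate values.  The tail may be infinite at \<open>T\<^sub>1 = T\<close>; a finite value below it is
  already exceeded slightly to the right of \<open>T\<^sub>1\<close>.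
\<close>
lemma tail_IVT:
  assumes T: "T \<le> T1" "T1 < T2" and fin: "gain_tail c T2 < \<infinity>"
    and r: "0 \<le> r" "gain_tail c T2 \<le> ennreal r" "ennreal r \<le> gain_tail c T1"
  obtains t where "T1 \<le> t" "t \<le> T2" "gain_tail c t = ennreal r"
proof (cases "ennreal r = gain_tail c T1")
  case True
  then show ?thesis using T by (intro that[of T1]) auto
next
  case False
  then have "ennreal r < gain_tail c T1" using r by simp
  then obtain s where s: "T1 < s" "ennreal r < gain_tail c s" by (rule tail_SUP[OF T(1)])
  have f: "gain_tail c t < \<infinity>" if "t \<ge> s" for t by (rule tail_finite[OF fin]) (use s T that in auto)
  have sT2: "s \<le> T2"
  proof (rule ccontr)
    assume "\<not> s \<le> T2"
    then have "gain_tail c s < gain_tail c T2" using T fin by (intro tail_strict[of T2]) auto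
    then show False using s r by auto
  qed
  let ?h = "\<lambda>t. enn2real (gain_tail c t)"
  have "(c s * exp (-s))-lipschitz_on {s..T2} ?h"
  proof (rule lipschitz_on_leI)
    fix x y assume xy: "x \<in> {s..T2}" "y \<in> {s..T2}" "x \<le> y"
    have "ennreal (?h x - ?h y) = gain_between x y"
      using xy f T s by (intro tail_real_diff[symmetric]) auto
    also have "\<dots> \<le> ennreal (c x * exp (- x) * (y - x))" using xy s T by (intro gain_between_upper) auto
    also have "\<dots> \<le> ennreal (c s * exp (- s) * (y - x))"
      using xy s T by (intro ennreal_leI mult_right_mono density_antimono) auto
    finally have 1: "?h x - ?h y \<le> c s * exp (- s) * (y - x)"
      using pos[of s] T s xy by (subst (asm) ennreal_le_iff) auto
    have "?h y \<le> ?h x" using tail_split[of x y] xy T s f[of x] by (intro enn2real_mono) auto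
    then show "dist (?h x) (?h y) \<le> c s * exp (- s) * dist x y"
      using 1 xy by (simp add: dist_real_def)
  qed (use pos[of s] s T in \<open>auto intro: mult_nonneg_nonneg\<close>)
  then have "continuous_on {s..T2} ?h" by (rule lipschitz_on_continuous_on)
  moreover have "?h T2 \<le> r" using r(1,2) by (metis enn2real_ennreal enn2real_mono ennreal_less_top)
  moreover have "r \<le> ?h s" using s(2) r(1) f[of s]
    by (metis enn2real_ennreal enn2real_mono infinity_ennreal_def less_le order_refl)
  ultimately obtain t where t: "s \<le> t" "t \<le> T2" "?h t = r" using IVT2'[of ?h T2 r s] sT2 by auto
  then have "gain_tail c t = ennreal r" using f[of t] by (metis ennreal_enn2real infinity_ennreal_def)
  then show ?thesis using t s by (intro that[of t]) auto
qed

end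

text \<open>
  The measures may be infinite near \<open>T\<^sub>1\<close>: the restrictions to \<open>(T\<^sub>1 + 1/n, T\<^sub>2]\<close> are finite and
  coincide, and monotone convergence does the rest.
\<close>
lemma nn_integral_eq_of_interval_measures_eq:
  fixes \<mu> \<nu> :: "real measure"
  assumes sets: "sets \<mu> = sets borel" "sets \<nu> = sets borel"
    and eq: "\<And>t. T1 < t \<Longrightarrow> t < T2 \<Longrightarrow> emeasure \<mu> {t<..T2} = emeasure \<nu> {t<..T2}"
    and fin: "\<And>t. T1 < t \<Longrightarrow> t < T2 \<Longrightarrow> emeasure \<mu> {t<..T2} < \<infinity>"
    and g [measurable]: "g \<in> borel_measurable borel"
  shows "(\<integral>\<^sup>+ x. g x * indicator {T1<..T2} x \<partial>\<mu>) = (\<integral>\<^sup>+ x. g x * indicator {T1<..T2} x \<partial>\<nu>)"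
proof -
  define s where "s n = T1 + 1 / real (Suc n)" for n
  have [measurable_cong]: "sets \<mu> = sets borel" "sets \<nu> = sets borel" by fact+
  have step: "(\<integral>\<^sup>+ x. g x * indicator {s n<..T2} x \<partial>\<mu>) = (\<integral>\<^sup>+ x. g x * indicator {s n<..T2} x \<partial>\<nu>)" for n
  proof (cases "s n < T2")
    case True
    have T1: "T1 < s n" by (simp add: s_def)
    let ?D = "\<lambda>M. density M (indicator {s n<..T2})"
    have em: "emeasure (?D M) {x<..} = (if max x (s n) < T2 then emeasure M {max x (s n)<..T2} else 0)"
      if [measurable_cong]: "sets M = sets borel" for M x
    proof -
      have "emeasure (?D M) {x<..} = (\<integral>\<^sup>+ y. indicator {s n<..T2} y * indicator {x<..} y \<partial>M)"
        by (subst emeasure_density) auto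
      also have "\<dots> = (\<integral>\<^sup>+ y. indicator {max x (s n)<..T2} y \<partial>M)"
        by (intro nn_integral_cong) (auto simp: indicator_def)
      also have "\<dots> = emeasure M {max x (s n)<..T2}"
        by (subst nn_integral_indicator) (auto simp: that)
      finally show ?thesis by auto
    qed
    have "?D \<mu> = ?D \<nu>"
    proof (rule measure_eqI_lessThan)
      fix x
      show "emeasure (?D \<mu>) {x<..} < \<infinity>" "emeasure (?D \<mu>) {x<..} = emeasure (?D \<nu>) {x<..}"
        using T1 eq[of "max x (s n)"] fin[of "max x (s n)"]
        by (auto simp: em[OF sets(1)] em[OF sets(2)] less_max_iff_disj)
    qed (auto simp: sets)
    then have "(\<integral>\<^sup>+ x. g x \<partial>?D \<mu>) = (\<integral>\<^sup>+ x. g x \<partial>?D \<nu>)" by simp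
    then show ?thesis by (subst (asm) (1 2) nn_integral_density) (auto simp: mult.commute)
  qed auto
  have lim: "(\<integral>\<^sup>+ x. g x * indicator {T1<..T2} x \<partial>M) = (SUP n. \<integral>\<^sup>+ x. g x * indicator {s n<..T2} x \<partial>M)"
    if [measurable_cong]: "sets M = sets borel" for M
  proof -
    have "(\<integral>\<^sup>+ x. g x * indicator {T1<..T2} x \<partial>M) = (\<integral>\<^sup>+ x. (SUP n. g x * indicator {s n<..T2} x) \<partial>M)"
    proof (intro nn_integral_cong)
      fix x
      show "g x * indicator {T1<..T2} x = (SUP n. g x * indicator {s n<..T2} x)"
      proof (cases "T1 < x")
        case True
        then obtain n where n: "1 / Suc n < x - T1" using nat_approx_posE[of "x - T1"] by auto
        show ?thesis
          by (rule antisym)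
            (use True n in \<open>auto intro!: SUP_upper2[of n] SUP_least simp: indicator_def s_def\<close>)
      next
        case False
        then have "\<not> s n < x" for n
          unfolding s_def by (smt (verit) divide_nonneg_nonneg of_nat_0_le_iff)
        then show ?thesis using False by (simp add: indicator_def)
      qed
    qed
    also have "\<dots> = (SUP n. \<integral>\<^sup>+ x. g x * indicator {s n<..T2} x \<partial>M)"
    proof (rule nn_integral_monotone_convergence_SUP)
      show "incseq (\<lambda>n x. g x * indicator {s n<..T2} x)"
      proof (intro incseq_SucI le_funI mult_left_mono)
        fix n and x :: real
        have "s (Suc n) \<le> s n" by (simp add: s_def frac_le)
        then show "(indicator {s n<..T2} x :: ennreal) \<le> indicator {s (Suc n)<..T2} x"
          by (auto simp: indicator_def)
      qed auto
    qed auto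
    finally show ?thesis .
  qed
  show ?thesis by (simp add: lim[OF sets(1)] lim[OF sets(2)] step)
qed

text \<open>
  The integrals over all shells \<open>{s < p \<le> T2}\<close> determine the image measure under \<open>p\<close>, and
  thereby all integrals with an additional factor \<open>k \<circ> p\<close>.
\<close>
lemma nn_integral_eq_of_sublevel_integrals_eq:
  fixes p :: "'x \<Rightarrow> real" and q :: "'y \<Rightarrow> real" and T1 T2 :: real
  assumes [measurable]: "p \<in> borel_measurable M" "g \<in> borel_measurable M"
      "q \<in> borel_measurable N" "h \<in> borel_measurable N" "k \<in> borel_measurable borel"
    and eq: "\<And>t. T1 < t \<Longrightarrow> t < T2 \<Longrightarrow>
      (\<integral>\<^sup>+ x. g x * indicator {t<..T2} (p x) \<partial>M) = (\<integral>\<^sup>+ y. h y * indicator {t<..T2} (q y) \<partial>N)"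
    and fin: "\<And>t. T1 < t \<Longrightarrow> t < T2 \<Longrightarrow> (\<integral>\<^sup>+ x. g x * indicator {t<..T2} (p x) \<partial>M) < \<infinity>"
  shows "(\<integral>\<^sup>+ x. k (p x) * g x * indicator {T1<..T2} (p x) \<partial>M)
    = (\<integral>\<^sup>+ y. k (q y) * h y * indicator {T1<..T2} (q y) \<partial>N)"
proof -
  let ?\<mu> = "distr (density M g) borel p" and ?\<nu> = "distr (density N h) borel q"
  have em: "emeasure ?\<mu> {t<..T2} = (\<integral>\<^sup>+ x. g x * indicator {t<..T2} (p x) \<partial>M)"
    "emeasure ?\<nu> {t<..T2} = (\<integral>\<^sup>+ y. h y * indicator {t<..T2} (q y) \<partial>N)" for t
    by (subst emeasure_distr; simp add: emeasure_density; intro nn_integral_cong; simp add: indicator_def)+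
  have "(\<integral>\<^sup>+ x. k x * indicator {T1<..T2} x \<partial>?\<mu>) = (\<integral>\<^sup>+ x. k x * indicator {T1<..T2} x \<partial>?\<nu>)"
    by (rule nn_integral_eq_of_interval_measures_eq) (use fin in \<open>auto simp: em eq[symmetric]\<close>)
  then show ?thesis
    by (simp add: nn_integral_distr nn_integral_density ac_simps)
qed

section \<open>Orthogonality from minimality\<close>

definition sq_int :: "'x measure \<Rightarrow> ('x \<Rightarrow> complex) \<Rightarrow> ennreal" where
  "sq_int M u = (\<integral>\<^sup>+ x. ennreal ((cmod (u x))\<^sup>2) \<partial>M)"

lemma sq_int_parallelogram:
  assumes [measurable]: "u \<in> borel_measurable M" "v \<in> borel_measurable M"
  shows "sq_int M (\<lambda>x. u x + v x) + sq_int M (\<lambda>x. u x - v x) = 2 * sq_int M u + 2 * sq_int M v"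
proof -
  have "(cmod (a + b))\<^sup>2 + (cmod (a - b))\<^sup>2 = 2 * (cmod a)\<^sup>2 + 2 * (cmod b)\<^sup>2" for a b
    unfolding cmod_power2 by (simp add: power2_eq_square algebra_simps)
  then have *: "ennreal ((cmod (a + b))\<^sup>2) + ennreal ((cmod (a - b))\<^sup>2) = 2 * ennreal ((cmod a)\<^sup>2) + 2 * ennreal ((cmod b)\<^sup>2)" for a b
    by (simp flip: ennreal_plus ennreal_mult' ennreal_numeral)
  have "(\<integral>\<^sup>+ x. ennreal ((cmod (u x + v x))\<^sup>2) + ennreal ((cmod (u x - v x))\<^sup>2) \<partial>M)
      = (\<integral>\<^sup>+ x. 2 * ennreal ((cmod (u x))\<^sup>2) + 2 * ennreal ((cmod (v x))\<^sup>2) \<partial>M)"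
    by (simp only: *)
  then show ?thesis
    unfolding sq_int_def by (simp add: nn_integral_add nn_integral_cmult)
qed

text \<open>
  The variational argument in a form with nonnegative integrands only: integrate
  \<open>|u + sv|\<^sup>2 + (s/2) |u - v|\<^sup>2 = |u|\<^sup>2 + (s/2) |u + v|\<^sup>2 + s\<^sup>2 |v|\<^sup>2\<close>, use minimality on the left
  and let \<open>s\<close> tend to 0.
\<close>
lemma sq_int_le_if_minimal:
  assumes [measurable]: "u \<in> borel_measurable M" "v \<in> borel_measurable M"
    and fin: "sq_int M u < \<infinity>" "sq_int M (\<lambda>x. u x + v x) < \<infinity>"
    and min: "\<And>s::real. 0 < s \<Longrightarrow> sq_int M u \<le> sq_int M (\<lambda>x. u x + of_real s * v x)"
  shows "sq_int M (\<lambda>x. u x - v x) \<le> sq_int M (\<lambda>x. u x + v x)"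
proof -
  have "sq_int M (\<lambda>x. (u x + v x) + u x) + sq_int M (\<lambda>x. (u x + v x) - u x)
      = 2 * sq_int M (\<lambda>x. u x + v x) + 2 * sq_int M u"
    by (rule sq_int_parallelogram) auto
  also have "\<dots> < \<infinity>" using fin by (simp add: ennreal_mult_less_top)
  finally have finv: "sq_int M v < \<infinity>" by (simp add: less_top)
  have par: "sq_int M (\<lambda>x. u x + v x) + sq_int M (\<lambda>x. u x - v x) = 2 * sq_int M u + 2 * sq_int M v"
    by (rule sq_int_parallelogram) auto
  also have "\<dots> < \<infinity>" using fin finv by (simp add: ennreal_mult_less_top)
  finally have finm: "sq_int M (\<lambda>x. u x - v x) < \<infinity>" by (simp add: less_top)
  obtain a where a: "sq_int M u = ennreal a" "a \<ge> 0" using fin by (cases "sq_int M u") auto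
  obtain d where d: "sq_int M v = ennreal d" "d \<ge> 0" using finv by (cases "sq_int M v") auto
  obtain p where p: "sq_int M (\<lambda>x. u x + v x) = ennreal p" "p \<ge> 0"
    using fin by (cases "sq_int M (\<lambda>x. u x + v x)") auto
  obtain m where m: "sq_int M (\<lambda>x. u x - v x) = ennreal m" "m \<ge> 0"
    using finm by (cases "sq_int M (\<lambda>x. u x - v x)") auto
  have bound: "m \<le> p + 2 * s * d" if s: "s > 0" for s
  proof -
    have "(cmod (a + of_real s * b))\<^sup>2 + (s / 2) * (cmod (a - b))\<^sup>2
        = (cmod a)\<^sup>2 + (s / 2) * (cmod (a + b))\<^sup>2 + s\<^sup>2 * (cmod b)\<^sup>2" for a b
      unfolding cmod_power2 by (simp add: power2_eq_square algebra_simps)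
    then have *: "ennreal ((cmod (a + of_real s * b))\<^sup>2) + ennreal (s / 2) * ennreal ((cmod (a - b))\<^sup>2)
        = ennreal ((cmod a)\<^sup>2) + ennreal (s / 2) * ennreal ((cmod (a + b))\<^sup>2)
            + ennreal (s\<^sup>2) * ennreal ((cmod b)\<^sup>2)" for a b
      using s by (simp flip: ennreal_plus ennreal_mult')
    have "sq_int M (\<lambda>x. u x + of_real s * v x) + ennreal (s / 2) * sq_int M (\<lambda>x. u x - v x)
        = sq_int M u + ennreal (s / 2) * sq_int M (\<lambda>x. u x + v x) + ennreal (s\<^sup>2) * sq_int M v"
    proof -
      have "(\<integral>\<^sup>+ x. ennreal ((cmod (u x + of_real s * v x))\<^sup>2) + ennreal (s / 2) * ennreal ((cmod (u x - v x))\<^sup>2) \<partial>M)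
          = (\<integral>\<^sup>+ x. ennreal ((cmod (u x))\<^sup>2) + ennreal (s / 2) * ennreal ((cmod (u x + v x))\<^sup>2)
              + ennreal (s\<^sup>2) * ennreal ((cmod (v x))\<^sup>2) \<partial>M)"
        by (simp only: *)
      then show ?thesis
        unfolding sq_int_def by (simp add: nn_integral_add nn_integral_cmult)
    qed
    then have "sq_int M u + ennreal (s / 2) * sq_int M (\<lambda>x. u x - v x)
        \<le> sq_int M u + ennreal (s / 2) * sq_int M (\<lambda>x. u x + v x) + ennreal (s\<^sup>2) * sq_int M v"
      using add_right_mono[OF min[OF s], of "ennreal (s / 2) * sq_int M (\<lambda>x. u x - v x)"] by (simp only:)
    then have "a + (s / 2) * m \<le> a + (s / 2) * p + s\<^sup>2 * d"
      using a d p m s by (simp flip: ennreal_plus ennreal_mult')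
    then have "s * m \<le> s * (p + 2 * s * d)" by (simp add: power2_eq_square algebra_simps)
    then show ?thesis using s by simp
  qed
  have "m \<le> p"
  proof (rule field_le_epsilon)
    fix e :: real assume e: "e > 0"
    \<comment> \<open>\<open>d + 1\<close> in place of \<open>d\<close>, which may be 0\<close>
    have "m \<le> p + 2 * (e / (2 * (d + 1))) * d" using e d by (intro bound) auto
    also have "\<dots> \<le> p + e" using e d by (simp add: field_simps)
    finally show "m \<le> p + e" .
  qed
  then show ?thesis using p m by (simp add: ennreal_leI)
qed

text \<open>
  The conclusion is the orthogonality of \<open>u\<close> and \<open>v\<close> over the reals, since
  \<open>|u + v|\<^sup>2 - |u - v|\<^sup>2\<close> is four times the real part of \<open>u cnj v\<close>.  As an equality of two nonnegative integrals it can be transported to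
  other weights in the same way as the norms themselves.
\<close>
lemma sq_int_symmetric_if_minimal:
  assumes [measurable]: "u \<in> borel_measurable M" "v \<in> borel_measurable M"
    and fin: "sq_int M u < \<infinity>" "sq_int M (\<lambda>x. u x + v x) < \<infinity>"
    and min: "\<And>s::real. sq_int M u \<le> sq_int M (\<lambda>x. u x + of_real s * v x)"
  shows "sq_int M (\<lambda>x. u x - v x) = sq_int M (\<lambda>x. u x + v x)"
proof (rule antisym)
  show 1: "sq_int M (\<lambda>x. u x - v x) \<le> sq_int M (\<lambda>x. u x + v x)"
    by (rule sq_int_le_if_minimal) (use fin min in auto)
  have min': "sq_int M u \<le> sq_int M (\<lambda>x. u x - of_real s * v x)" for s
    using min[of "- s"] by simp
  have "sq_int M (\<lambda>x. u x - (- v x)) \<le> sq_int M (\<lambda>x. u x + (- v x))"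
    by (rule sq_int_le_if_minimal)
      (use fin 1 min' in \<open>auto simp: le_less_trans\<close>)
  then show "sq_int M (\<lambda>x. u x + v x) \<le> sq_int M (\<lambda>x. u x - v x)" by simp
qed

section \<open>Integration over a manifold as integration over one measure space\<close>

lemma sigma_finite_measure_completion:
  assumes "sigma_finite_measure M"
  shows "sigma_finite_measure (completion M)"
proof
  obtain A where A: "countable A" "A \<subseteq> sets M" "\<Union>A = space M" "\<forall>a\<in>A. emeasure M a \<noteq> \<infinity>"
    using sigma_finite_measure.sigma_finite_countable[OF assms] by blast
  then show "\<exists>A. countable A \<and> A \<subseteq> sets (completion M) \<and> \<Union>A = space (completion M) \<and> (\<forall>a\<in>A. emeasure (completion M) a \<noteq> \<infinity>)"
    by (intro exI[of _ A]) (auto intro: sets_completionI_sets simp: subset_iff)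
qed

lemma
  assumes "is_chart C"
  shows open_chart_range: "open (snd C ` fst C)"
    and open_chart_domain: "open (fst C)"
    and continuous_on_chart: "continuous_on (fst C) (snd C)"
    and continuous_on_chart_inv: "continuous_on (snd C ` fst C) (chart_inv C)"
    and chart_inv_chart: "\<And>x. x \<in> fst C \<Longrightarrow> chart_inv C (snd C x) = x"
    and inj_on_chart: "inj_on (snd C) (fst C)"
proof -
  have h: "homeomorphism (fst C) (snd C ` fst C) (snd C) (chart_inv C)"
    using assms by (simp add: is_chart_def)
  show "open (snd C ` fst C)" "open (fst C)" using assms by (auto simp: is_chart_def)
  show "continuous_on (fst C) (snd C)" "continuous_on (snd C ` fst C) (chart_inv C)"
    using h by (auto simp: homeomorphism_def)
  show inv: "chart_inv C (snd C x) = x" if "x \<in> fst C" for x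
    using h that by (auto simp: homeomorphism_def)
  show "inj_on (snd C) (fst C)" by (rule inj_on_inverseI) (rule inv)
qed

lemma holo_fun_continuous_on: "holo_fun f S \<Longrightarrow> continuous_on S f"
  unfolding holo_fun_def
  by (meson continuous_at_imp_continuous_on has_derivative_continuous)

text \<open>
  The disjoint union of the coordinate images of the cells of a partition, with Lebesgue measure.
  It turns the sum of chart integrals into a single integral, so that measure theory can be
  applied to the coefficients of forms as to ordinary functions.
\<close>
definition coord_space :: "(nat \<Rightarrow> ('a, 'n::finite) chart \<times> 'a set) \<Rightarrow> (nat \<times> (complex^'n)) measure" where
  "coord_space P = restrict_space (count_space UNIV \<Otimes>\<^sub>M lebesgue)
     (SIGMA i:UNIV. snd (fst (P i)) ` snd (P i))"

definition coord_point :: "(nat \<Rightarrow> ('a, 'n::finite) chart \<times> 'a set) \<Rightarrow> nat \<times> (complex^'n) \<Rightarrow> 'a" where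
  "coord_point P y = chart_inv (fst (P (fst y))) (snd y)"

text \<open>
  The chart is that of the cell, so that no choice is involved.  The extension by 0 makes the
  coefficient measurable on the whole coordinate space, whatever the domain of the form.
\<close>
definition coord_coef ::
  "(nat \<Rightarrow> ('a, 'n::finite) chart \<times> 'a set) \<Rightarrow> ('a, 'n) form \<Rightarrow> nat \<times> (complex^'n) \<Rightarrow> complex" where
  "coord_coef P F y = (if coord_point P y \<in> dom F then coef F (fst (P (fst y))) (coord_point P y) else 0)"

locale partitioned_manifold =
  fixes \<A> :: "('a::{t2_space, second_countable_topology}, 'n::finite) chart set"
    and P :: "nat \<Rightarrow> ('a, 'n) chart \<times> 'a set"
  assumes manifold: "complex_manifold \<A>" and partition: "chart_partition \<A> P"
begin

abbreviation patch :: "nat \<Rightarrow> (complex^'n) set" where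
  "patch i \<equiv> snd (fst (P i)) ` snd (P i)"

lemma chart: "fst (P i) \<in> \<A>" "is_chart (fst (P i))"
  using partition manifold by (auto simp: chart_partition_def complex_manifold_def)

lemma cell: "snd (P i) \<in> sets borel" "snd (P i) \<subseteq> fst (fst (P i))"
  using partition by (auto simp: chart_partition_def)

lemma patch_subset: "patch i \<subseteq> snd (fst (P i)) ` fst (fst (P i))"
  using cell by blast

lemma chart_inv_measurable:
  "chart_inv (fst (P i)) \<in> borel_measurable (restrict_space borel (snd (fst (P i)) ` fst (fst (P i))))"
  by (intro borel_measurable_continuous_on_restrict continuous_on_chart_inv chart)

lemma patch_borel: "patch i \<in> sets borel"
proof -
  let ?O = "snd (fst (P i)) ` fst (fst (P i))"
  have "chart_inv (fst (P i)) -` snd (P i) \<inter> space (restrict_space borel ?O) \<in> sets (restrict_space borel ?O)"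
    by (rule measurable_sets[OF chart_inv_measurable cell(1)])
  then have "chart_inv (fst (P i)) -` snd (P i) \<inter> ?O \<in> sets borel"
    using open_chart_range[OF chart(2)] by (simp add: sets_restrict_space_iff space_restrict_space)
  also have "chart_inv (fst (P i)) -` snd (P i) \<inter> ?O = patch i"
  proof (rule equalityI; rule subsetI)
    fix z assume "z \<in> chart_inv (fst (P i)) -` snd (P i) \<inter> ?O"
    then have "z = snd (fst (P i)) (chart_inv (fst (P i)) z)" "chart_inv (fst (P i)) z \<in> snd (P i)"
      by (auto simp: f_inv_into_f)
    then show "z \<in> patch i" by (rule image_eqI)
  next
    fix z assume "z \<in> patch i"
    then obtain x where x: "x \<in> snd (P i)" "z = snd (fst (P i)) x" by auto
    moreover have "x \<in> fst (fst (P i))" using x(1) cell(2) by blast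
    ultimately show "z \<in> chart_inv (fst (P i)) -` snd (P i) \<inter> ?O"
      using chart_inv_chart[OF chart(2)] by auto
  qed
  finally show ?thesis .
qed

lemma patches_measurable: "(SIGMA i:UNIV. patch i) \<in> sets (count_space UNIV \<Otimes>\<^sub>M lebesgue)"
proof -
  have "(SIGMA i:UNIV. patch i) = (\<Union>i. {i} \<times> patch i)" by auto
  also have "\<dots> \<in> sets (count_space UNIV \<Otimes>\<^sub>M lebesgue)"
    using patch_borel by (intro sets.countable_UN) (auto intro!: pair_measureI)
  finally show ?thesis .
qed

lemma measurable_coord_space:
  assumes "\<And>i. (\<lambda>z. f (i, z)) \<in> measurable (restrict_space lebesgue (patch i)) N" "c \<in> space N"
  shows "f \<in> measurable (coord_space P) N"
proof -
  let ?E = "SIGMA i:UNIV. patch i"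
  have "(\<lambda>y. if y \<in> ?E then f y else c) \<in> measurable (count_space UNIV \<Otimes>\<^sub>M lebesgue) N"
  proof (rule measurable_pair_measure_countable1)
    fix i
    have "(\<lambda>z. if z \<in> patch i then f (i, z) else c) \<in> measurable lebesgue N"
      using assms patch_borel[of i] by (subst measurable_restrict_space_iff[symmetric]) auto
    then show "(\<lambda>z. if (i, z) \<in> ?E then f (i, z) else c) \<in> measurable lebesgue N" by simp
  qed auto
  then show ?thesis
    unfolding coord_space_def using patches_measurable assms(2)
    by (subst measurable_restrict_space_iff) (auto simp: space_pair_measure)
qed

lemma nn_integral_coord_space:
  assumes "g \<in> borel_measurable (coord_space P)"
  shows "(\<integral>\<^sup>+ y. g y \<partial>coord_space P) = (\<Sum>i. \<integral>\<^sup>+ z. g (i, z) * indicator (patch i) z \<partial>lebesgue)"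
proof -
  let ?E = "SIGMA i:UNIV. patch i"
  interpret leb: sigma_finite_measure "lebesgue :: (complex^'n) measure"
    by (intro sigma_finite_measure_completion sigma_finite_lborel)
  have "(\<lambda>y. if y \<in> ?E then g y else 0) \<in> borel_measurable (count_space UNIV \<Otimes>\<^sub>M lebesgue)"
    using assms patches_measurable unfolding coord_space_def
    by (subst (asm) measurable_restrict_space_iff[where c=0]) (auto simp: space_pair_measure)
  also have "(\<lambda>y. if y \<in> ?E then g y else 0) = (\<lambda>y. g y * indicator ?E y)"
    by (auto simp: indicator_def)
  finally have m: "(\<lambda>y. g y * indicator ?E y) \<in> borel_measurable (count_space UNIV \<Otimes>\<^sub>M lebesgue)" .
  have "(\<integral>\<^sup>+ y. g y \<partial>coord_space P) = (\<integral>\<^sup>+ y. g y * indicator ?E y \<partial>(count_space UNIV \<Otimes>\<^sub>M lebesgue))"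
    unfolding coord_space_def using patches_measurable
    by (intro nn_integral_restrict_space) (auto simp: space_pair_measure)
  also have "\<dots> = (\<integral>\<^sup>+ i. \<integral>\<^sup>+ z. g (i, z) * indicator ?E (i, z) \<partial>lebesgue \<partial>count_space UNIV)"
    by (rule leb.nn_integral_fst[OF m, symmetric])
  also have "\<dots> = (\<Sum>i. \<integral>\<^sup>+ z. g (i, z) * indicator (patch i) z \<partial>lebesgue)"
    by (subst nn_integral_count_space_nat) (auto intro!: suminf_cong nn_integral_cong simp: indicator_def)
  finally show ?thesis .
qed

lemma measurable_restrict_lebesgue:
  assumes "f \<in> measurable (restrict_space borel A) N" "B \<subseteq> A"
  shows "f \<in> measurable (restrict_space lebesgue B) N"
proof -
  have "f \<in> measurable (restrict_space lebesgue A) N"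
  proof (rule measurable_compose[OF _ assms(1), where f="\<lambda>x. x"])
    show "(\<lambda>x. x) \<in> restrict_space lebesgue A \<rightarrow>\<^sub>M restrict_space borel A"
      by (rule measurable_restrict_space3) (auto simp: measurable_completion)
  qed
  then show ?thesis by (rule measurable_restrict_mono) fact
qed

lemma coord_point_measurable [measurable]: "coord_point P \<in> borel_measurable (coord_space P)"
proof (rule measurable_coord_space)
  fix i
  show "(\<lambda>z. coord_point P (i, z)) \<in> borel_measurable (restrict_space lebesgue (patch i))"
    unfolding coord_point_def fst_conv snd_conv
    by (rule measurable_restrict_lebesgue[OF chart_inv_measurable patch_subset])
qed auto

lemma mfd_measurable_coord:
  assumes "mfd_measurable \<A> \<phi>"
  shows "(\<lambda>y. \<phi> (coord_point P y)) \<in> borel_measurable (coord_space P)"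
proof (rule measurable_coord_space)
  fix i
  have "\<phi> \<circ> chart_inv (fst (P i)) \<in> borel_measurable (restrict_space lebesgue (snd (fst (P i)) ` fst (fst (P i))))"
    using assms chart(1) unfolding mfd_measurable_def by blast
  then show "(\<lambda>z. \<phi> (coord_point P (i, z))) \<in> borel_measurable (restrict_space lebesgue (patch i))"
    unfolding coord_point_def fst_conv snd_conv o_def
    by (rule measurable_restrict_mono) (rule patch_subset)
qed auto

lemma coord_coef_measurable:
  assumes F: "F \<in> holo_forms \<A> W"
  shows "coord_coef P F \<in> borel_measurable (coord_space P)"
proof (rule measurable_coord_space)
  fix i
  let ?C = "fst (P i)" and ?O = "snd (fst (P i)) ` fst (fst (P i))"
  let ?A = "snd (fst (P i)) ` (fst (fst (P i)) \<inter> W)"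
  have W: "open W" "dom F = W" using F by (auto simp: holo_forms_def)
  have "open ?A" by (rule open_chart_image[OF chart(2) W(1)])
  have "continuous_on ?A (coef F ?C \<circ> chart_inv ?C)"
    using F chart(1) by (intro holo_fun_continuous_on) (auto simp: holo_forms_def)
  then have "coef F ?C \<circ> chart_inv ?C \<in> borel_measurable (restrict_space borel ?A)"
    by (rule borel_measurable_continuous_on_restrict)
  then have "(\<lambda>z. if z \<in> ?A then (coef F ?C \<circ> chart_inv ?C) z else 0) \<in> borel_measurable borel"
    using \<open>open ?A\<close> by (subst (asm) measurable_restrict_space_iff[where c=0]) auto
  then have "(\<lambda>z. if z \<in> ?A then (coef F ?C \<circ> chart_inv ?C) z else 0) \<in> borel_measurable (restrict_space lebesgue (patch i))"
    by (intro measurable_restrict_lebesgue[OF measurable_restrict_space1 patch_subset])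
  then show "(\<lambda>z. coord_coef P F (i, z)) \<in> borel_measurable (restrict_space lebesgue (patch i))"
  proof (rule measurable_cong[THEN iffD1, rotated])
    fix z assume "z \<in> space (restrict_space lebesgue (patch i))"
    then obtain x where x: "x \<in> snd (P i)" "z = snd ?C x" by (auto simp: space_restrict_space)
    have "x \<in> fst ?C" using x cell(2) by auto
    have "z \<in> ?A \<longleftrightarrow> x \<in> W"
      using inj_on_chart[OF chart(2)] x \<open>x \<in> fst ?C\<close> by (auto simp: inj_on_def)
    then show "(if z \<in> ?A then (coef F ?C \<circ> chart_inv ?C) z else 0) = coord_coef P F (i, z)"
      using W x \<open>x \<in> fst ?C\<close> chart_inv_chart[OF chart(2)]
      by (simp add: coord_coef_def coord_point_def)
  qed
qed auto

definition weighted :: "('a \<Rightarrow> ennreal) \<Rightarrow> 'a set \<Rightarrow> (nat \<times> (complex^'n)) measure" where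
  "weighted w D = density (coord_space P) (\<lambda>y. 2 ^ CARD('n) * w (coord_point P y) * indicator D (coord_point P y))"

lemma sq_int_weighted:
  assumes [measurable]: "u \<in> borel_measurable (coord_space P)"
    "(\<lambda>y. w (coord_point P y)) \<in> borel_measurable (coord_space P)" "D \<in> sets borel"
  shows "sq_int (weighted w D) u = (\<integral>\<^sup>+ y. 2 ^ CARD('n) * ennreal ((cmod (u y))\<^sup>2) * w (coord_point P y)
     * indicator D (coord_point P y) \<partial>coord_space P)"
  unfolding sq_int_def weighted_def
  by (subst nn_integral_density) (auto simp: ac_simps)

text \<open>
  Charts are injective, so integrating over the image of a cell cut with \<open>D\<close> means integrating
  over those coordinates in the image of the cell whose point lies in \<open>D\<close>.
\<close>
lemma chart_integral_sum:
  assumes F: "F \<in> holo_forms \<A> W" "D \<subseteq> W" and D[measurable]: "D \<in> sets borel"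
    and w[measurable]: "(\<lambda>y. w (coord_point P y)) \<in> borel_measurable (coord_space P)"
  shows "(\<Sum>i. chart_integral (fst (P i)) (snd (P i) \<inter> D) F w) = sq_int (weighted w D) (coord_coef P F)"
proof -
  note [measurable] = coord_coef_measurable[OF F(1)]
  have W: "dom F = W" using F by (auto simp: holo_forms_def)
  show ?thesis
    unfolding sq_int_weighted[OF coord_coef_measurable[OF F(1)] w D]
  proof (subst nn_integral_coord_space, measurable, intro suminf_cong)
    fix i
    show "chart_integral (fst (P i)) (snd (P i) \<inter> D) F w = (\<integral>\<^sup>+ z. 2 ^ CARD('n) * ennreal ((cmod (coord_coef P F (i, z)))\<^sup>2) *
            w (coord_point P (i, z)) * indicator D (coord_point P (i, z)) * indicator (patch i) z \<partial>lebesgue)"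
      unfolding chart_integral_def
    proof (intro nn_integral_cong)
      fix z
      show "ennreal (2 ^ CARD('n) * (cmod (coef F (fst (P i)) (chart_inv (fst (P i)) z)))\<^sup>2) * w (chart_inv (fst (P i)) z) *
            indicator (snd (fst (P i)) ` (snd (P i) \<inter> D)) z =
        2 ^ CARD('n) * ennreal ((cmod (coord_coef P F (i, z)))\<^sup>2) * w (coord_point P (i, z)) *
            indicator D (coord_point P (i, z)) * indicator (patch i) z"
      proof (cases "z \<in> patch i")
        case True
        then obtain x where x: "x \<in> snd (P i)" "z = snd (fst (P i)) x" by auto
        have xC: "x \<in> fst (fst (P i))" using x cell(2) by auto
        have "z \<in> snd (fst (P i)) ` (snd (P i) \<inter> D) \<longleftrightarrow> x \<in> D"
        proof -
          have "x \<in> snd (P i) \<inter> D \<longleftrightarrow> x \<in> D" using x by simp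
          moreover have "snd (P i) \<inter> D \<subseteq> fst (fst (P i))" using cell(2) by blast
          ultimately show ?thesis
            unfolding x(2) using inj_on_image_mem_iff[OF inj_on_chart[OF chart(2)] xC] by simp
        qed
        then show ?thesis using True x xC F(2) W chart_inv_chart[OF chart(2)]
          by (auto simp: coord_coef_def coord_point_def indicator_def ennreal_mult' ennreal_power[symmetric])
      next
        case False
        then show ?thesis by (auto simp: indicator_def)
      qed
    qed
  qed
qed

end

section \<open>Sublevel sets, weights and combinations of forms\<close>

lemma open_psh_sublevel:
  assumes A: "complex_manifold \<A>" and psh: "psh \<A> UNIV \<psi>"
  shows "open {x. \<psi> x < a}"
proof -
  have eq: "{x. \<psi> x < a} = (\<Union>C\<in>\<A>. {x \<in> fst C. \<psi> x < a})"
    using A unfolding complex_manifold_def by blast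
  have "open {x \<in> fst C. \<psi> x < a}" if C: "C \<in> \<A>" for C
  proof -
    have ch: "is_chart C" using A C unfolding complex_manifold_def by blast
    let ?B = "{z \<in> snd C ` (fst C \<inter> UNIV). (\<psi> \<circ> chart_inv C) z < a}"
    have "psh_coord (\<psi> \<circ> chart_inv C) (snd C ` (fst C \<inter> UNIV))"
      using psh C unfolding psh_def by blast
    then have "open ?B" unfolding psh_coord_def by blast
    then have "open (fst C \<inter> snd C -` ?B)"
      using continuous_on_chart[OF ch] open_chart_domain[OF ch] by (intro continuous_open_preimage)
    also have "fst C \<inter> snd C -` ?B = {x \<in> fst C. \<psi> x < a}"
      using chart_inv_chart[OF ch] by (auto dest: inj_onD[OF inj_on_chart[OF ch]])
    finally show ?thesis .
  qed
  then show ?thesis unfolding eq by blast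
qed

lemma open_sublevel:
  "complex_manifold \<A> \<Longrightarrow> psh \<A> UNIV \<psi> \<Longrightarrow> open (sublevel \<psi> t)"
  unfolding sublevel_def by (rule open_psh_sublevel)

lemma psh_borel_measurable:
  "complex_manifold \<A> \<Longrightarrow> psh \<A> UNIV \<psi> \<Longrightarrow> \<psi> \<in> borel_measurable borel"
  by (rule borel_measurableI_less) (auto intro: borel_open open_psh_sublevel)

lemma exp_neg_measurable [measurable]: "exp_neg \<in> borel_measurable borel"
proof -
  have inf: "exp_neg \<infinity> = 0" "exp_neg (-\<infinity>) = \<infinity>"
    by (simp_all only: infinity_ereal_def uminus_ereal.simps exp_neg.simps)
  have "exp_neg = (\<lambda>x. if x = \<infinity> then 0 else if x = -\<infinity> then \<infinity> else ennreal (exp (- real_of_ereal x)))"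
  proof
    fix x show "exp_neg x = (if x = \<infinity> then 0 else if x = -\<infinity> then \<infinity> else ennreal (exp (- real_of_ereal x)))"
      by (cases x) (auto simp: inf)
  qed
  also have "\<dots> \<in> borel_measurable borel" by measurable
  finally show ?thesis .
qed

lemma weight_eq:
  assumes "\<forall>x. \<psi> x < ereal (- T)"
  shows "weight \<phi> \<psi> c x = (if \<psi> x = -\<infinity> then 0
     else exp_neg (\<phi> x) * ennreal (trunc T c (real_of_ereal (- \<psi> x))))"
  using assms[rule_format, of x] by (cases "\<psi> x") (auto simp: weight_def trunc_def)

definition form_comb ::
  "'a set \<Rightarrow> complex \<Rightarrow> ('a, 'n) form \<Rightarrow> complex \<Rightarrow> ('a, 'n) form \<Rightarrow> ('a, 'n) form" where
  "form_comb W a F b G = (\<lambda>p. if p \<in> W then Some (\<lambda>C. a * coef F C p + b * coef G C p) else None)"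

lemma coef_form_comb: "p \<in> W \<Longrightarrow> coef (form_comb W a F b G) C p = a * coef F C p + b * coef G C p"
  by (simp add: form_comb_def coef_def)

lemma restrict_form_eq_comb: "W \<subseteq> dom F \<Longrightarrow> F |` W = form_comb W 1 F 0 F"
proof
  fix p assume "W \<subseteq> dom F"
  then show "(F |` W) p = form_comb W 1 F 0 F p"
    by (cases "p \<in> W") (auto simp: form_comb_def coef_def restrict_map_def)
qed

lemma form_comb_holo_forms:
  assumes A: "complex_manifold \<A>" and F: "F \<in> holo_forms \<A> V" and G: "G \<in> holo_forms \<A> V'"
    and W: "open W" "W \<subseteq> V" "W \<subseteq> V'"
  shows "form_comb W a F b G \<in> holo_forms \<A> W"
  unfolding holo_forms_def
proof (intro CollectI conjI ballI)
  show "dom (form_comb W a F b G) = W" by (auto simp: form_comb_def split: if_splits)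
next
  fix p assume "p \<in> W"
  then show "\<forall>C. C \<notin> \<A> \<or> p \<notin> fst C \<longrightarrow> coef (form_comb W a F b G) C p = 0"
    using F G W by (auto simp: holo_forms_def coef_form_comb subset_iff)
next
  fix C D p assume C: "C \<in> \<A>" "D \<in> \<A>" and p: "p \<in> W \<inter> fst C \<inter> fst D"
  then have p': "p \<in> V \<inter> fst C \<inter> fst D" "p \<in> V' \<inter> fst C \<inter> fst D" using W by auto
  have "coef F C p = coef F D p * det (complex_jacobian (transition C D) (snd C p))"
    using F C p'(1) unfolding holo_forms_def by blast
  moreover have "coef G C p = coef G D p * det (complex_jacobian (transition C D) (snd C p))"
    using G C p'(2) unfolding holo_forms_def by blast
  ultimately show "coef (form_comb W a F b G) C p = coef (form_comb W a F b G) D p * det (complex_jacobian (transition C D) (snd C p))"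
    using p by (simp add: coef_form_comb algebra_simps)
next
  fix C assume C: "C \<in> \<A>"
  have ch: "is_chart C" using A C unfolding complex_manifold_def by blast
  let ?A = "snd C ` (fst C \<inter> W)"
  have oA: "open ?A" by (rule open_chart_image[OF ch W(1)])
  have "holo_fun (coef F C \<circ> chart_inv C) (snd C ` (fst C \<inter> V))"
    "holo_fun (coef G C \<circ> chart_inv C) (snd C ` (fst C \<inter> V'))"
    using F G C by (auto simp: holo_forms_def)
  then have "holo_fun (coef F C \<circ> chart_inv C) ?A" "holo_fun (coef G C \<circ> chart_inv C) ?A"
    using W oA by (auto elim!: holo_fun_subset)
  then have h: "holo_fun (\<lambda>z. a * (coef F C \<circ> chart_inv C) z + b * (coef G C \<circ> chart_inv C) z) ?A"
    using oA by (intro holo_fun_add holo_fun_mult holo_fun_const)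
  have eq: "a * (coef F C \<circ> chart_inv C) z + b * (coef G C \<circ> chart_inv C) z
      = (coef (form_comb W a F b G) C \<circ> chart_inv C) z" if "z \<in> ?A" for z
    using that chart_inv_chart[OF ch] by (auto simp: coef_form_comb)
  show "holo_fun (coef (form_comb W a F b G) C \<circ> chart_inv C) ?A"
    unfolding holo_fun_def
  proof (intro conjI ballI oA)
    fix z assume z: "z \<in> ?A"
    then obtain L where L: "((\<lambda>z. a * (coef F C \<circ> chart_inv C) z + b * (coef G C \<circ> chart_inv C) z) has_derivative L) (at z)"
       "\<forall>c v. L (c *s v) = c * L v" using h unfolding holo_fun_def by blast
    have "((coef (form_comb W a F b G) C \<circ> chart_inv C) has_derivative L) (at z)"
      by (rule has_derivative_transform_within_open[OF L(1) oA z eq])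
    then show "\<exists>L. ((coef (form_comb W a F b G) C \<circ> chart_inv C) has_derivative L) (at z) \<and> (\<forall>c v. L (c *s v) = c * L v)"
      using L(2) by blast
  qed
qed (rule W(1))

lemma germ_cong:
  assumes "eventually (\<lambda>x. f x = g x) (nhds z)"
  shows "germ z f = germ z g"
proof -
  have "eventually (\<lambda>x. h x = f x) (nhds z) \<longleftrightarrow> eventually (\<lambda>x. h x = g x) (nhds z)" for h
    by (rule eventually_cong[OF assms]) auto
  then show ?thesis by (simp add: germ_def)
qed

lemma diff_in_cong:
  assumes "open W" "Z0 \<subseteq> W" "\<And>C p. p \<in> W \<Longrightarrow> coef F C p = coef G C p"
  shows "diff_in \<A> F f Z0 \<F> \<longleftrightarrow> diff_in \<A> G f Z0 \<F>"
proof -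
  have "germ z (\<lambda>p. coef F C p - coef f C p) = germ z (\<lambda>p. coef G C p - coef f C p)" if "z \<in> Z0" for z C
    by (rule germ_cong, rule eventually_nhds[THEN iffD2], rule exI[of _ W])
      (use assms that in auto)
  then show ?thesis by (auto simp: diff_in_def)
qed

text \<open>
  Competitors form an affine space: with \<open>a + b = 1\<close> the difference to \<open>f\<close> is the combination
  \<open>a (F - f) + b (G - f)\<close>, whose germ lies in the ideal, constants being elements of the stalk.
\<close>
lemma diff_in_comb:
  assumes A: "complex_manifold \<A>" and W: "open W" "Z0 \<subseteq> W"
    and F: "diff_in \<A> F f Z0 \<F>" and G: "diff_in \<A> G f Z0 \<F>"
    and I: "\<forall>z\<in>Z0. ideal (\<F> z) (stalk \<A> z)" and ab: "a + b = 1"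
  shows "diff_in \<A> (form_comb W a F b G) f Z0 \<F>"
  unfolding diff_in_def
proof (intro ballI impI)
  fix z C assume z: "z \<in> Z0" and C: "C \<in> \<A>" "z \<in> fst C"
  interpret ideal "\<F> z" "stalk \<A> z" using I z by blast
  have const: "germ z (\<lambda>_. k) \<in> carrier (stalk \<A> z)" for k
    by (rule stalk_carrierI[of _ UNIV]) (auto intro: mfd_holo_const A)
  let ?F = "\<lambda>p. coef F C p - coef f C p" and ?G = "\<lambda>p. coef G C p - coef f C p"
  have "germ z ?F \<in> \<F> z" "germ z ?G \<in> \<F> z"
    using F G z C by (auto simp: diff_in_def)
  then have "germ z (\<lambda>_. a) \<otimes>\<^bsub>stalk \<A> z\<^esub> germ z ?F \<oplus>\<^bsub>stalk \<A> z\<^esub> germ z (\<lambda>_. b) \<otimes>\<^bsub>stalk \<A> z\<^esub> germ z ?G \<in> \<F> z"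
    by (intro additive_subgroup.a_closed[OF additive_subgroup_axioms] I_l_closed const)
  then have "germ z (\<lambda>p. a * ?F p + b * ?G p) \<in> \<F> z"
    by (simp only: stalk_mult_germ stalk_add_germ)
  also have "germ z (\<lambda>p. a * ?F p + b * ?G p) = germ z (\<lambda>p. coef (form_comb W a F b G) C p - coef f C p)"
  proof (rule germ_cong, rule eventually_nhds[THEN iffD2], intro exI[of _ W] conjI ballI)
    fix p assume "p \<in> W"
    have "a * ?F p + b * ?G p = a * coef F C p + b * coef G C p - (a + b) * coef f C p"
      by (simp add: algebra_simps)
    then show "a * ?F p + b * ?G p = coef (form_comb W a F b G) C p - coef f C p"
      using \<open>p \<in> W\<close> ab by (simp add: coef_form_comb)
  qed (use W z in auto)
  finally show "germ z (\<lambda>p. coef (form_comb W a F b G) C p - coef f C p) \<in> \<F> z" .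
qed

section \<open>Weighted energies and the exchange of the gain\<close>

locale weighted_manifold = partitioned_manifold \<A> P
  for \<A> :: "('a::{t2_space, second_countable_topology}, 'n::finite) chart set"
    and P :: "nat \<Rightarrow> ('a, 'n) chart \<times> 'a set" +
  fixes \<phi> \<psi> :: "'a \<Rightarrow> ereal" and T :: real
  assumes psh: "psh \<A> UNIV \<psi>" and psi_less: "\<forall>x. \<psi> x < ereal (- T)"
    and phi: "mfd_measurable \<A> \<phi>"
begin

definition energy :: "(real \<Rightarrow> real) \<Rightarrow> 'a set \<Rightarrow> (nat \<times> (complex^'n) \<Rightarrow> complex) \<Rightarrow> ennreal" where
  "energy c D u = sq_int (weighted (weight \<phi> \<psi> c) D) u"

definition depth :: "nat \<times> (complex^'n) \<Rightarrow> real" where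
  "depth y = real_of_ereal (- \<psi> (coord_point P y))"

text \<open>
  The part of the integrand without the gain.  It vanishes where \<open>\<psi> = -\<infinity>\<close>, like the weight
  itself; this also hides the arbitrary value 0 that \<open>depth\<close> has there.
\<close>
definition base :: "(nat \<times> (complex^'n) \<Rightarrow> complex) \<Rightarrow> nat \<times> (complex^'n) \<Rightarrow> ennreal" where
  "base u y = 2 ^ CARD('n) * ennreal ((cmod (u y))\<^sup>2) *
     (if \<psi> (coord_point P y) = -\<infinity> then 0 else exp_neg (\<phi> (coord_point P y)))"

lemma psi_measurable [measurable]: "\<psi> \<in> borel_measurable borel"
  by (rule psh_borel_measurable[OF manifold psh])

lemma phi_measurable [measurable]: "(\<lambda>y. \<phi> (coord_point P y)) \<in> borel_measurable (coord_space P)"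
  by (rule mfd_measurable_coord[OF phi])

lemma sublevel_measurable [measurable]: "sublevel \<psi> t \<in> sets borel"
  using open_sublevel[OF manifold psh] by (rule borel_open)

lemma depth_measurable [measurable]: "depth \<in> borel_measurable (coord_space P)"
  unfolding depth_def[abs_def] by measurable

lemma base_measurable [measurable]:
  assumes [measurable]: "u \<in> borel_measurable (coord_space P)"
  shows "base u \<in> borel_measurable (coord_space P)"
  unfolding base_def[abs_def] by measurable

lemma weight_measurable [measurable]:
  assumes "gain T c"
  shows "(\<lambda>y. weight \<phi> \<psi> c (coord_point P y)) \<in> borel_measurable (coord_space P)"
proof -
  note [measurable] = gain.meas[OF assms]
  show ?thesis unfolding weight_eq[OF psi_less] by measurable
qed

lemma energy_eq:
  assumes "gain T c" "u \<in> borel_measurable (coord_space P)" "D \<in> sets borel"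
  shows "energy c D u = (\<integral>\<^sup>+ y. 2 ^ CARD('n) * ennreal ((cmod (u y))\<^sup>2) * weight \<phi> \<psi> c (coord_point P y)
     * indicator D (coord_point P y) \<partial>coord_space P)"
  unfolding energy_def using assms by (intro sq_int_weighted weight_measurable)

lemma energy_disjoint_Un:
  assumes g: "gain T c" and u[measurable]: "u \<in> borel_measurable (coord_space P)"
    and D[measurable]: "D \<in> sets borel" "E \<in> sets borel" and "D \<inter> E = {}"
  shows "energy c (D \<union> E) u = energy c D u + energy c E u"
proof -
  note [measurable] = weight_measurable[OF g]
  have "D \<union> E \<in> sets borel" by simp
  then show ?thesis
    using assms
    by (simp add: energy_eq flip: nn_integral_add)
      (auto intro!: nn_integral_cong simp: indicator_def)
qed

lemma energy_cong:
  assumes g: "gain T c" and uv: "u \<in> borel_measurable (coord_space P)" "v \<in> borel_measurable (coord_space P)"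
    and D: "D \<in> sets borel" and eq: "\<And>y. coord_point P y \<in> D \<Longrightarrow> u y = v y"
  shows "energy c D u = energy c D v"
  using assms by (auto simp: energy_eq indicator_def intro!: nn_integral_cong)

definition shell :: "real \<Rightarrow> real \<Rightarrow> 'a set" where
  "shell s t = sublevel \<psi> s - sublevel \<psi> t"

lemma shell_measurable [measurable]: "shell s t \<in> sets borel"
  unfolding shell_def by measurable

lemma energy_sublevel:
  assumes "gain T c" "u \<in> borel_measurable (coord_space P)" "s \<le> t"
  shows "energy c (sublevel \<psi> s) u = energy c (shell s t) u + energy c (sublevel \<psi> t) u"
proof -
  have "sublevel \<psi> s = shell s t \<union> sublevel \<psi> t"
    using assms(3) by (auto simp: shell_def sublevel_def elim!: less_le_trans)
  then show ?thesis
    by (simp only:) (rule energy_disjoint_Un[OF assms(1,2)], auto simp: shell_def)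
qed

lemma energy_shell:
  assumes g: "gain T c" and u[measurable]: "u \<in> borel_measurable (coord_space P)"
  shows "energy c (shell s t) u
    = (\<integral>\<^sup>+ y. ennreal (trunc T c (depth y)) * base u y * indicator {s<..t} (depth y) \<partial>coord_space P)"
  unfolding energy_eq[OF g u shell_measurable]
proof (intro nn_integral_cong)
  fix y
  let ?x = "coord_point P y"
  show "2 ^ CARD('n) * ennreal ((cmod (u y))\<^sup>2) * weight \<phi> \<psi> c ?x * indicator (shell s t) ?x
    = ennreal (trunc T c (depth y)) * base u y * indicator {s<..t} (depth y)"
  proof (cases "\<psi> ?x")
    case (real r)
    have "?x \<in> shell s t \<longleftrightarrow> depth y \<in> {s<..t}"
      using real by (auto simp: shell_def sublevel_def depth_def)
    then have "(indicator (shell s t) ?x :: ennreal) = indicator {s<..t} (depth y)"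
      by (simp add: indicator_def)
    then show ?thesis using real
      by (simp add: weight_eq[OF psi_less] base_def depth_def ac_simps)
  qed (use psi_less[rule_format, of ?x] in \<open>auto simp: weight_def base_def\<close>)
qed

text \<open>
  The energies on the shells between \<open>s\<close> and \<open>T2\<close> for all \<open>s > t\<close> and one gain \<open>c'\<close> fix the image
  of the gain-free integrand under \<open>depth\<close>, because \<open>c'\<close> is positive and can be divided out.  The
  comparison space \<open>N\<close> is the real line with density \<open>\<alpha> e\<^bsup>-l\<^esup>\<close> in one application and the
  coordinate space with a second function in the other.
\<close>
lemma shell_change_gain:
  fixes h :: "'y \<Rightarrow> ennreal"
  assumes c: "gain T c" and c': "gain T c'" and u[measurable]: "u \<in> borel_measurable (coord_space P)"
    and h [measurable]: "h \<in> borel_measurable N" "q \<in> borel_measurable N" and t: "T \<le> t"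
    and eq: "\<And>s. t < s \<Longrightarrow> s < T2 \<Longrightarrow> energy c' (shell s T2) u
      = (\<integral>\<^sup>+ y. ennreal (trunc T c' (q y)) * h y * indicator {s<..T2} (q y) \<partial>N)"
    and fin: "\<And>s. t < s \<Longrightarrow> s < T2 \<Longrightarrow> energy c' (shell s T2) u < \<infinity>"
  shows "energy c (shell t T2) u
      = (\<integral>\<^sup>+ y. ennreal (trunc T c (q y)) * h y * indicator {t<..T2} (q y) \<partial>N)"
proof -
  note [measurable] = gain.meas[OF c] gain.meas[OF c']
  \<comment> \<open>multiplication by this quotient replaces the gain \<open>c'\<close> by \<open>c\<close>\<close>
  let ?k = "\<lambda>l. ennreal (trunc T c l / trunc T c' l)"
  have "0 < trunc T c l" "0 < trunc T c' l" if "t < l" for l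
    using that t gain.pos[OF c, of l] gain.pos[OF c', of l] by (auto simp: trunc_def)
  then have k: "?k l * (ennreal (trunc T c' l) * a) * indicator {t<..T2} l
      = ennreal (trunc T c l) * a * indicator {t<..T2} l" for l a
    by (auto simp: indicator_def mult.assoc[symmetric] less_imp_le simp flip: ennreal_mult)
      (metis less_irrefl nonzero_eq_divide_eq)
  have "(\<integral>\<^sup>+ y. ?k (depth y) * (ennreal (trunc T c' (depth y)) * base u y) * indicator {t<..T2} (depth y) \<partial>coord_space P)
      = (\<integral>\<^sup>+ y. ?k (q y) * (ennreal (trunc T c' (q y)) * h y) * indicator {t<..T2} (q y) \<partial>N)"
    by (rule nn_integral_eq_of_sublevel_integrals_eq)
      (measurable, use eq fin in \<open>simp_all add: energy_shell[OF c' u]\<close>)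
  then show ?thesis by (simp only: k energy_shell[OF c u])
qed

text \<open>
  A linear dependence of the energy on the tail of one gain means that the energy has density
  \<open>\<alpha> e\<^bsup>-l\<^esup>\<close> in the depth, and then it depends linearly, with the same slope, on the tail of any
  other gain.  The tail of \<open>c'\<close> at \<open>T1\<close> may be infinite, so linearity is only assumed to the right
  of \<open>T1\<close>.
\<close>
lemma energy_shell_of_linear:
  assumes c: "gain T c" and c': "gain T c'" and u[measurable]: "u \<in> borel_measurable (coord_space P)"
    and T: "T \<le> T1" "T1 < T2" and fin: "gain_tail c' T2 < \<infinity>"
    and lin: "\<And>s. T1 < s \<Longrightarrow> s \<le> T2 \<Longrightarrow>
      enn2ereal (energy c' (sublevel \<psi> s) u) = ereal (\<alpha> * enn2real (gain_tail c' s) + \<beta>)"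
    and t: "T1 \<le> t" "t \<le> T2"
  shows "0 \<le> \<alpha>" "energy c (shell t T2) u = ennreal \<alpha> * gain.gain_between c t T2"
proof -
  interpret c': gain T c' by (rule c')
  interpret c: gain T c by (rule c)
  have lin': "energy c' (sublevel \<psi> s) u = ennreal (\<alpha> * enn2real (gain_tail c' s) + \<beta>)"
      "0 \<le> \<alpha> * enn2real (gain_tail c' s) + \<beta>" if "T1 < s" "s \<le> T2" for s
  proof -
    show "0 \<le> \<alpha> * enn2real (gain_tail c' s) + \<beta>"
      using lin[OF that] enn2ereal_nonneg by (metis ereal_less_eq(5))
    show "energy c' (sublevel \<psi> s) u = ennreal (\<alpha> * enn2real (gain_tail c' s) + \<beta>)"
      using lin[OF that] by (metis e2ennreal_enn2ereal e2ennreal_ereal)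
  qed
  have tail: "gain_tail c' s < \<infinity>" if "T1 < s" for s
    by (rule c'.tail_finite[OF fin]) (use T that in auto)
  have strict: "enn2real (gain_tail c' T2) < enn2real (gain_tail c' s)" if "T1 < s" "s < T2" for s
  proof -
    have "gain_tail c' T2 < gain_tail c' s" using T that by (intro c'.tail_strict[OF fin]) auto
    then show ?thesis using tail[OF that(1)] fin
      by (cases "gain_tail c' s"; cases "gain_tail c' T2") (auto simp: ennreal_less_iff)
  qed
  have shell': "energy c' (shell s T2) u = ennreal (\<alpha> * (enn2real (gain_tail c' s) - enn2real (gain_tail c' T2)))
      \<and> 0 \<le> \<alpha> * (enn2real (gain_tail c' s) - enn2real (gain_tail c' T2))" if s: "T1 < s" "s < T2" for s
  proof -
    have sum: "energy c' (sublevel \<psi> s) u = energy c' (shell s T2) u + energy c' (sublevel \<psi> T2) u"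
      using s by (intro energy_sublevel c' u) auto
    have "energy c' (shell s T2) u \<noteq> \<infinity>"
      using sum lin'(1)[of s] s by (metis ennreal_add_eq_top ennreal_neq_top infinity_ennreal_def less_imp_le)
    then obtain a where a: "energy c' (shell s T2) u = ennreal a" "0 \<le> a"
      by (cases "energy c' (shell s T2) u") auto
    have "\<alpha> * enn2real (gain_tail c' s) + \<beta> = a + (\<alpha> * enn2real (gain_tail c' T2) + \<beta>)"
      using sum a lin'[of s] lin'[of T2] s T by (simp flip: ennreal_plus)
    then show ?thesis using a by (auto simp: algebra_simps)
  qed
  define m where "m = (T1 + T2) / 2"
  have m: "T1 < m" "m < T2" using T by (auto simp: m_def)
  show \<alpha>: "0 \<le> \<alpha>"
    using shell'[OF m] strict[OF m] by (simp add: zero_le_mult_iff)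
  have "energy c (shell t T2) u = (\<integral>\<^sup>+ l. ennreal (trunc T c l) * ennreal (\<alpha> * exp (- l)) * indicator {t<..T2} l \<partial>lborel)"
  proof (rule shell_change_gain[OF c c' u, where q="\<lambda>l. l" and h="\<lambda>l. ennreal (\<alpha> * exp (- l))"])
    fix s assume "t < s" "s < T2"
    then have s: "T1 < s" "s < T2" using t by auto
    have "energy c' (shell s T2) u = ennreal \<alpha> * c'.gain_between s T2"
    proof -
      have "c'.gain_between s T2 = ennreal (enn2real (gain_tail c' s) - enn2real (gain_tail c' T2))"
        by (rule c'.tail_real_diff) (use tail[OF s(1)] s fin T in auto)
      then show ?thesis using shell'[OF s] \<alpha> by (simp add: ennreal_mult')
    qed
    also have "\<dots> = (\<integral>\<^sup>+ l. ennreal (trunc T c' l) * ennreal (\<alpha> * exp (- l)) * indicator {s<..T2} l \<partial>lborel)"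
      using s T \<alpha> by (intro c'.scaled_gain_between_eq) auto
    finally show "energy c' (shell s T2) u = (\<integral>\<^sup>+ l. ennreal (trunc T c' l) * ennreal (\<alpha> * exp (- l)) * indicator {s<..T2} l \<partial>lborel)" .
    show "energy c' (shell s T2) u < \<infinity>" using shell'[OF s] by simp
  qed (use T t in auto)
  also have "\<dots> = ennreal \<alpha> * gain.gain_between c t T2"
    using t T \<alpha> by (intro c.scaled_gain_between_eq[symmetric]) auto
  finally show "energy c (shell t T2) u = ennreal \<alpha> * gain.gain_between c t T2" .
qed

text \<open>
  Minimality for \<open>c'\<close> on all sublevel sets makes \<open>u + v\<close> and \<open>u - v\<close> equally expensive on all
  shells, for \<open>c'\<close> and hence for \<open>c\<close>.  The parallelogram law for \<open>c\<close> then leaves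
  \<open>|u + v|\<^sup>2 = |u|\<^sup>2 + |v|\<^sup>2\<close> in the integral.
\<close>
lemma energy_shell_le_if_minimal:
  assumes c: "gain T c" and c': "gain T c'"
    and uv[measurable]: "u \<in> borel_measurable (coord_space P)" "v \<in> borel_measurable (coord_space P)"
    and T: "T \<le> t" "t \<le> T2"
    and fin: "energy c' (sublevel \<psi> t) u < \<infinity>" "energy c' (sublevel \<psi> t) (\<lambda>y. u y + v y) < \<infinity>"
    and min: "\<And>s r. t \<le> s \<Longrightarrow> s \<le> T2 \<Longrightarrow>
      energy c' (sublevel \<psi> s) u \<le> energy c' (sublevel \<psi> s) (\<lambda>y. u y + of_real r * v y)"
  shows "energy c (shell t T2) u \<le> energy c (shell t T2) (\<lambda>y. u y + v y)"
proof -
  let ?p = "\<lambda>y. u y + v y" and ?m = "\<lambda>y. u y - v y"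
  have pm: "?p \<in> borel_measurable (coord_space P)" "?m \<in> borel_measurable (coord_space P)"
    by measurable
  have sm: "f \<in> borel_measurable (weighted w D)" if "f \<in> borel_measurable (coord_space P)" for f :: "nat \<times> (complex^'n) \<Rightarrow> complex" and w D
    using that by (simp add: weighted_def)
  have fins: "energy c' (sublevel \<psi> s) f < \<infinity>"
    if "energy c' (sublevel \<psi> t) f < \<infinity>" "f \<in> borel_measurable (coord_space P)" "t \<le> s" for f s
    using that energy_sublevel[OF c' that(2,3)] by (auto simp: less_top[symmetric])
  have sym: "energy c' (sublevel \<psi> s) ?m = energy c' (sublevel \<psi> s) ?p" if s: "t \<le> s" "s \<le> T2" for s
    unfolding energy_def
  proof (rule sq_int_symmetric_if_minimal)
    let ?M = "weighted (weight \<phi> \<psi> c') (sublevel \<psi> s)"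
    show "u \<in> borel_measurable ?M" "v \<in> borel_measurable ?M" by (rule sm; fact)+
    show "sq_int ?M u < \<infinity>" using fins[OF fin(1) uv(1) s(1)] unfolding energy_def .
    show "sq_int ?M ?p < \<infinity>" using fins[OF fin(2) pm(1) s(1)] unfolding energy_def .
    show "sq_int ?M u \<le> sq_int ?M (\<lambda>y. u y + of_real r * v y)" for r
      using min[OF s] unfolding energy_def .
  qed
  have shell: "energy c' (shell s T2) ?p = energy c' (shell s T2) ?m \<and> energy c' (shell s T2) ?p < \<infinity>"
    if s: "t \<le> s" "s \<le> T2" for s
  proof -
    have f: "energy c' (sublevel \<psi> s) ?p < \<infinity>" by (rule fins[OF fin(2) pm(1) s(1)])
    have "energy c' (sublevel \<psi> s) ?p = energy c' (shell s T2) ?p + energy c' (sublevel \<psi> T2) ?p"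
      "energy c' (sublevel \<psi> s) ?m = energy c' (shell s T2) ?m + energy c' (sublevel \<psi> T2) ?m"
      by (rule energy_sublevel[OF c' _ s(2)]; fact pm)+
    moreover from this have "energy c' (shell s T2) ?p < \<infinity>" "energy c' (sublevel \<psi> T2) ?p \<noteq> \<infinity>"
      using f by (auto simp: less_top[symmetric])
    ultimately show ?thesis
      using sym[OF s] sym[of T2] T ennreal_add_left_cancel[of "energy c' (sublevel \<psi> T2) ?p"]
      by (simp add: add.commute)
  qed
  have "energy c (shell t T2) ?p = (\<integral>\<^sup>+ y. ennreal (trunc T c (depth y)) * base ?m y * indicator {t<..T2} (depth y) \<partial>coord_space P)"
  proof (rule shell_change_gain[OF c c' pm(1), where q=depth and h="base ?m"])
    fix s assume s: "t < s" "s < T2"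
    show "energy c' (shell s T2) ?p = (\<integral>\<^sup>+ y. ennreal (trunc T c' (depth y)) * base ?m y * indicator {s<..T2} (depth y) \<partial>coord_space P)"
      using shell[of s] s energy_shell[OF c' pm(2), of s T2] by simp
    show "energy c' (shell s T2) ?p < \<infinity>"
      by (rule shell[THEN conjunct2]) (use s in auto)
  qed (use T in auto)
  also have "\<dots> = energy c (shell t T2) ?m" by (rule energy_shell[OF c pm(2), symmetric])
  finally have eq: "energy c (shell t T2) ?p = energy c (shell t T2) ?m" .
  have "energy c (shell t T2) ?p + energy c (shell t T2) ?m = 2 * energy c (shell t T2) u + 2 * energy c (shell t T2) v"
    unfolding energy_def by (rule sq_int_parallelogram; rule sm; fact)
  then have "2 * energy c (shell t T2) ?p = 2 * energy c (shell t T2) u + 2 * energy c (shell t T2) v"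
    by (simp add: eq mult_2)
  then have "2 * energy c (shell t T2) u \<le> 2 * energy c (shell t T2) ?p" by simp
  then show ?thesis by (subst (asm) ennreal_mult_le_mult_iff) auto
qed

lemma energy_mono:
  assumes "gain T c" "u \<in> borel_measurable (coord_space P)" "D \<in> sets borel" "E \<in> sets borel" "D \<subseteq> E"
  shows "energy c D u \<le> energy c E u"
proof -
  have "E = D \<union> (E - D)" using assms by auto
  then have "energy c E u = energy c D u + energy c (E - D) u"
    using energy_disjoint_Un[of c u D "E - D"] assms by auto
  then show ?thesis by simp
qed

lemma form_integral_eq_energy:
  assumes P: "P = (SOME P. chart_partition \<A> P)" and c: "gain T c"
    and F: "F \<in> holo_forms \<A> W" "D \<subseteq> W" "D \<in> sets borel"
  shows "form_integral \<A> D F (weight \<phi> \<psi> c) = energy c D (coord_coef P F)"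
  unfolding form_integral_def Let_def P[symmetric] energy_def
  using assms by (intro chart_integral_sum weight_measurable)

end

lemma (in partitioned_manifold) weighted_cong:
  assumes "\<And>x. x \<in> D \<Longrightarrow> w x = w' x"
  shows "weighted w D = weighted w' D"
proof -
  have "(\<lambda>y. 2 ^ CARD('n) * w (coord_point P y) * indicator D (coord_point P y) :: ennreal)
      = (\<lambda>y. 2 ^ CARD('n) * w' (coord_point P y) * indicator D (coord_point P y))"
    using assms by (auto simp: indicator_def)
  then show ?thesis unfolding weighted_def by (rule arg_cong)
qed

lemma coef_restrict: "p \<in> W \<Longrightarrow> coef (F |` W) C p = coef F C p"
  by (simp add: coef_def)

lemma coord_coef_restrict:
  "coord_point P y \<in> W \<Longrightarrow> W \<subseteq> dom F \<Longrightarrow> coord_coef P (F |` W) y = coord_coef P F y"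
  by (simp add: coord_coef_def coef_restrict subset_iff)

lemma restrict_holo_forms:
  assumes "complex_manifold \<A>" "F \<in> holo_forms \<A> V" "open W" "W \<subseteq> V"
  shows "F |` W \<in> holo_forms \<A> W"
proof -
  have "W \<subseteq> dom F" using assms by (auto simp: holo_forms_def)
  then show ?thesis using assms by (simp only: restrict_form_eq_comb form_comb_holo_forms)
qed

lemma gain_of_gain_class: "c \<in> gain_class T Z \<phi> \<psi> \<Longrightarrow> gain T c"
  unfolding gain_class_def by unfold_locales auto

lemma dom_holo_forms: "F \<in> holo_forms \<A> W \<Longrightarrow> dom F = W"
  by (simp add: holo_forms_def)

section \<open>Transfer of linearity\<close>

theorem theorem1p7:
  fixes \<A> :: "('a::{t2_space, second_countable_topology}, 'n::finite) chart set"
    and X Z Z0 Z0' U :: "'a set"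
    and \<phi> \<psi> \<phi>' \<psi>' :: "'a \<Rightarrow> ereal"
    and \<F> \<F>' :: "'a \<Rightarrow> ('a \<Rightarrow> complex) set set"
    and f F' :: "('a, 'n) form"
    and c c' :: "real \<Rightarrow> real"
    and T T1 T2 :: real
  assumes condA: "condition_A \<A> X Z"
    and psh_psi: "psh \<A> UNIV \<psi>" "\<forall>x. \<psi> x < ereal (- T)"
    and psh_psi': "psh \<A> UNIV \<psi>'" "\<forall>x. \<psi>' x < ereal (- T)"
    and phi: "mfd_measurable \<A> \<phi>" "psh_sum \<A> \<phi> \<psi>"
    and phi': "mfd_measurable \<A> \<phi>'" "psh_sum \<A> \<phi>' \<psi>'"
    and data: "admissible_data \<A> \<phi> \<psi> Z0 \<F>"
    and data': "admissible_data \<A> \<phi>' \<psi>' Z0' \<F>'"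
    and f: "f \<in> holo_forms \<A> U" "Z0 \<subseteq> U" "Z0' \<subseteq> U"
    and T12: "T \<le> T1" "T1 < T2"
    and c: "c \<in> gain_class T Z \<phi> \<psi>" "gain_tail c T2 < \<infinity>"
    and c': "c' \<in> gain_class T Z \<phi>' \<psi>'" "gain_tail c' T2 < \<infinity>"
    and one: "sublevel \<psi> T1 \<subseteq> sublevel \<psi>' T1" "sublevel \<psi> T2 \<subseteq> sublevel \<psi>' T2"
    and two: "\<forall>x. ereal (- T2) \<le> \<psi> x \<and> \<psi> x < ereal (- T1) \<longrightarrow> \<psi>' x = \<psi> x \<and> \<phi>' x = \<phi> x"
    and three: "Z0' = Z0"
      "\<forall>z\<in>Z0. multiplier_ideal \<A> (\<lambda>x. \<phi>' x + \<psi>' x) z \<subseteq> multiplier_ideal \<A> (\<lambda>x. \<phi> x + \<psi> x) z"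
      "\<forall>z\<in>Z0. \<F> z \<subseteq> \<F>' z"
    and four: "\<forall>t\<in>{T1..T2}. H2 \<A> f Z0 \<F> c t \<phi> \<psi> \<subseteq> H2 \<A> f Z0' \<F>' c' t \<phi>' \<psi>'"
    and linear: "linear_between
      (\<lambda>r. min_L2 \<A> f Z0' \<F>' (inv_into {T..} (gain_tail c') r) \<phi>' \<psi>' c')
      (gain_tail c' T2) (gain_tail c' T1)"
    and F': "F' \<in> holo_forms \<A> (sublevel \<psi>' T1)" "diff_in \<A> F' f Z0' \<F>'"
      "\<forall>t\<in>{T1..T2}. form_integral \<A> (sublevel \<psi>' t) F' (weight \<phi>' \<psi>' c')
          = min_L2 \<A> f Z0' \<F>' t \<phi>' \<psi>' c'"
    and F'_minimal: "F' |` sublevel \<psi> T2 \<in> H2 \<A> f Z0 \<F> c T2 \<phi> \<psi>"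
      "form_integral \<A> (sublevel \<psi> T2) F' (weight \<phi> \<psi> c) = min_L2 \<A> f Z0 \<F> T2 \<phi> \<psi> c"
  shows "linear_between
      (\<lambda>r. min_L2 \<A> f Z0 \<F> (inv_into {T..} (gain_tail c) r) \<phi> \<psi> c)
      (gain_tail c T2) (gain_tail c T1)"
proof -
  have A: "complex_manifold \<A>" using condA by (simp add: condition_A_def)
  define P where P: "P = (SOME P. chart_partition \<A> P)"
  have part: "chart_partition \<A> P"
    unfolding P by (rule someI_ex[OF chart_partition_exists[OF A]])
  interpret W: weighted_manifold \<A> P \<phi> \<psi> T
    by unfold_locales (use A part psh_psi phi in auto)
  interpret W': weighted_manifold \<A> P \<phi>' \<psi>' T
    by unfold_locales (use A part psh_psi' phi' in auto)
  have gc: "gain T c" and gc': "gain T c'" using c(1) c'(1) by (auto intro: gain_of_gain_class)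
  interpret c: gain T c by (rule gc)
  interpret c': gain T c' by (rule gc')
  let ?S = "sublevel \<psi>" and ?S' = "sublevel \<psi>'" and ?h = "gain_tail c" and ?h' = "gain_tail c'"
  define G where "G t = min_L2 \<A> f Z0 \<F> t \<phi> \<psi> c" for t
  define G' where "G' t = min_L2 \<A> f Z0' \<F>' t \<phi>' \<psi>' c'" for t
  note oS = open_sublevel[OF A psh_psi(1)] and oS' = open_sublevel[OF A psh_psi'(1)]
  note I = W.form_integral_eq_energy[OF P gc] and I' = W'.form_integral_eq_energy[OF P gc']
  have anti: "?S t \<subseteq> ?S s" "?S' t \<subseteq> ?S' s" if "s \<le> t" for s t
    using that by (auto simp: sublevel_def elim!: less_le_trans)
  have Z0: "Z0 \<subseteq> ?S t" "Z0 \<subseteq> ?S' t" for t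
    using data data' three(1) by (auto simp: admissible_data_def sublevel_def)
  define u where "u = coord_coef P F'"
  have um [measurable]: "u \<in> borel_measurable (coord_space P)"
    unfolding u_def by (rule W.coord_coef_measurable[OF F'(1)])
  have domF': "dom F' = ?S' T1" by (rule dom_holo_forms[OF F'(1)])
  have S_sub: "?S t \<subseteq> ?S' T1" if "T1 \<le> t" for t using anti(1)[OF that] one(1) by blast

  \<comment> \<open>an element of both spaces has both sublevel sets as its domain\<close>
  have H2_sublevel: "?S t = ?S' t" if "t \<in> {T1..T2}" "H \<in> H2 \<A> f Z0 \<F> c t \<phi> \<psi>" for t H
  proof -
    have "H \<in> H2 \<A> f Z0' \<F>' c' t \<phi>' \<psi>'" using four that by blast
    then have "dom H = ?S' t" by (auto simp: H2_def dest: dom_holo_forms)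
    moreover have "dom H = ?S t" using that by (auto simp: H2_def dest: dom_holo_forms)
    ultimately show ?thesis by simp
  qed
  have ST2: "?S T2 = ?S' T2" using H2_sublevel[OF _ F'_minimal(1)] T12 by simp

  have res: "F' |` ?S t \<in> holo_forms \<A> (?S t)" if "T1 \<le> t" for t
    by (rule restrict_holo_forms[OF A F'(1) oS S_sub[OF that]])
  have diff_res: "diff_in \<A> (F' |` ?S t) f Z0 \<F>" if "t \<le> T2" for t
  proof -
    have "diff_in \<A> (F' |` ?S T2) f Z0 \<F>" using F'_minimal(1) by (simp add: H2_def)
    then show ?thesis
      by (subst diff_in_cong[OF oS Z0(1)[of T2]]) (use anti(1)[OF that] in \<open>auto simp: coef_restrict\<close>)
  qed
  have energy_res: "form_integral \<A> (?S t) (F' |` ?S t) (weight \<phi> \<psi> c) = W.energy c (?S t) u" if "T1 \<le> t" for t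
    unfolding I[OF res[OF that] order_refl W.sublevel_measurable]
    by (rule W.energy_cong[OF gc W.coord_coef_measurable[OF res[OF that]] um W.sublevel_measurable])
      (simp add: u_def domF' S_sub[OF that] coord_coef_restrict)
  have G2: "G T2 = W.energy c (?S T2) u"
    using F'_minimal(2) I[OF F'(1) S_sub] T12 by (simp add: G_def u_def)
  have G2_fin: "G T2 < \<infinity>"
    using F'_minimal(1) energy_res[of T2] T12 unfolding G2 H2_def by auto
  have shell_weights: "W.energy c D v = W'.energy c D v" if "D \<subseteq> W.shell T1 T2" for D v
  proof -
    have "weight \<phi> \<psi> c x = weight \<phi>' \<psi>' c x" if "x \<in> D" for x
    proof -
      have "ereal (- T2) \<le> \<psi> x \<and> \<psi> x < ereal (- T1)"
        using that \<open>D \<subseteq> W.shell T1 T2\<close> by (auto simp: W.shell_def sublevel_def not_less)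
      then show ?thesis using two by (simp add: weight_def)
    qed
    then show ?thesis
      unfolding W.energy_def W'.energy_def by (simp cong: W.weighted_cong)
  qed

  obtain \<alpha> \<beta> where lin: "\<And>r. 0 \<le> r \<Longrightarrow> ?h' T2 \<le> ennreal r \<Longrightarrow> ennreal r \<le> ?h' T1 \<Longrightarrow>
      enn2ereal (G' (inv_into {T..} ?h' (ennreal r))) = ereal (\<alpha> * r + \<beta>)"
    using linear unfolding linear_between_def G'_def by blast
  have lin': "enn2ereal (W'.energy c' (?S' s) u) = ereal (\<alpha> * enn2real (?h' s) + \<beta>)" if s: "T1 < s" "s \<le> T2" for s
  proof -
    have "?h' s < \<infinity>" by (rule c'.tail_finite[OF c'(2)]) (use s T12 in auto)
    then have r: "ennreal (enn2real (?h' s)) = ?h' s" by simp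
    have "?h' T2 \<le> ?h' s" "?h' s \<le> ?h' T1"
      using c'.tail_split[of s T2] c'.tail_split[of T1 s] s T12 by auto
    then have "enn2ereal (G' s) = ereal (\<alpha> * enn2real (?h' s) + \<beta>)"
      using lin[of "enn2real (?h' s)"] c'.inv_tail[OF c'(2), of s] s T12 unfolding r by simp
    moreover have "G' s = W'.energy c' (?S' s) u"
      using F'(3) s I'[OF F'(1) anti(2)[of T1 s] W'.sublevel_measurable] by (simp add: G'_def u_def)
    ultimately show ?thesis by simp
  qed
  have \<alpha>: "0 \<le> \<alpha>"
    by (rule W'.energy_shell_of_linear(1)[OF gc gc' um T12 c'(2) lin', of T2]) (use T12 in auto)
  have shell_u: "W'.energy c (W'.shell t T2) u = ennreal \<alpha> * c.gain_between t T2" if "T1 \<le> t" "t \<le> T2" for t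
    by (rule W'.energy_shell_of_linear(2)[OF gc gc' um T12 c'(2) lin' that])

  \<comment> \<open>A priori the shell of \<open>\<psi>\<close> is only contained in that of \<open>\<psi>'\<close>.  This already bounds the
      energy of \<open>F'\<close> for \<open>c\<close>, so that \<open>F'\<close> lies in the space for \<open>c\<close>; then the sublevel sets, and with
      them the shells, coincide, and the bound is an equality.\<close>
  have upper: "?S t = ?S' t \<and> W.energy c (?S t) u = ennreal \<alpha> * c.gain_between t T2 + G T2"
    if t: "T1 \<le> t" "t \<le> T2" "?h t < \<infinity>" for t
  proof -
    have split: "W.energy c (?S t) u = W'.energy c (W.shell t T2) u + G T2"
    proof -
      have "W.shell t T2 \<subseteq> W.shell T1 T2" using anti(1)[OF t(1)] by (auto simp: W.shell_def)
      then show ?thesis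
        using W.energy_sublevel[OF gc um t(2)] by (simp add: shell_weights G2)
    qed
    have "W.shell t T2 \<subseteq> W'.shell t T2"
    proof
      fix x assume "x \<in> W.shell t T2"
      then have x: "ereal (- T2) \<le> \<psi> x" "\<psi> x < ereal (- t)" by (auto simp: W.shell_def sublevel_def not_less)
      moreover have "ereal (- t) \<le> ereal (- T1)" using t by simp
      ultimately have "\<psi>' x = \<psi> x" using two by (meson less_le_trans)
      then show "x \<in> W'.shell t T2" using x by (simp add: W'.shell_def sublevel_def not_less)
    qed
    then have "W'.energy c (W.shell t T2) u \<le> W'.energy c (W'.shell t T2) u"
      by (intro W'.energy_mono gc um) auto
    also have "\<dots> = ennreal \<alpha> * c.gain_between t T2" by (rule shell_u[OF t(1,2)])
    also have "\<dots> < \<infinity>"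
    proof -
      have "c.gain_between t T2 < \<infinity>"
        using c.tail_split[of t T2] t T12 by (auto simp: less_top[symmetric])
      then show ?thesis by (simp add: ennreal_mult_less_top)
    qed
    finally have fin: "W.energy c (?S t) u < \<infinity>" using split G2_fin by (simp add: less_top[symmetric])
    have "F' |` ?S t \<in> H2 \<A> f Z0 \<F> c t \<phi> \<psi>"
      using res[OF t(1)] energy_res[OF t(1)] diff_res[OF t(2)] fin by (simp add: H2_def)
    then have St: "?S t = ?S' t" using t by (intro H2_sublevel) auto
    then have "W.shell t T2 = W'.shell t T2" by (simp add: W.shell_def W'.shell_def ST2)
    then show ?thesis using St split shell_u[OF t(1,2)] by simp
  qed

  have G_eq: "G t = ennreal \<alpha> * c.gain_between t T2 + G T2" if t: "T1 \<le> t" "t \<le> T2" "?h t < \<infinity>" for t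
  proof (rule antisym)
    have "G t \<le> form_integral \<A> (?S t) (F' |` ?S t) (weight \<phi> \<psi> c)"
      unfolding G_def min_L2_def by (intro INF_lower) (use res[OF t(1)] diff_res[OF t(2)] in auto)
    then show "G t \<le> ennreal \<alpha> * c.gain_between t T2 + G T2" using upper[OF t, THEN conjunct2] energy_res[OF t(1)] by simp
    show "ennreal \<alpha> * c.gain_between t T2 + G T2 \<le> G t"
      unfolding G_def[of t] min_L2_def
    proof (rule INF_greatest, clarify)
      fix F assume F: "F \<in> holo_forms \<A> (?S t)" "diff_in \<A> F f Z0 \<F>"
      define x where "x = coord_coef P F"
      define v where "v y = x y - u y" for y
      have xm [measurable]: "x \<in> borel_measurable (coord_space P)"
        unfolding x_def by (rule W.coord_coef_measurable[OF F(1)])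
      have vm [measurable]: "v \<in> borel_measurable (coord_space P)" unfolding v_def[abs_def] by measurable
      have IF: "form_integral \<A> (?S t) F (weight \<phi> \<psi> c) = W.energy c (?S t) x"
        unfolding x_def by (rule I[OF F(1) order_refl W.sublevel_measurable])
      have "ennreal \<alpha> * c.gain_between t T2 + G T2 \<le> W.energy c (?S t) x"
      proof (cases "W.energy c (?S t) x < \<infinity>")
        case True
        have "F \<in> H2 \<A> f Z0 \<F> c t \<phi> \<psi>" using F True IF by (simp add: H2_def)
        then have FH: "F \<in> H2 \<A> f Z0' \<F>' c' t \<phi>' \<psi>'" using four t by auto
        have F2: "F \<in> holo_forms \<A> (?S' t)" "diff_in \<A> F f Z0' \<F>'" using FH by (auto simp: H2_def)
        have x_fin: "W'.energy c' (?S' t) x < \<infinity>"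
          using FH I'[OF F2(1) order_refl W'.sublevel_measurable] by (simp add: H2_def x_def)
        have min: "W'.energy c' (?S' s) u \<le> W'.energy c' (?S' s) (\<lambda>y. u y + of_real r * v y)"
          if s: "t \<le> s" "s \<le> T2" for s r
        proof -
          \<comment> \<open>the form \<open>F' + r (F - F')\<close>\<close>
          let ?L = "form_comb (?S' s) (of_real (1 - r)) F' (of_real r) F"
          have L: "?L \<in> holo_forms \<A> (?S' s)"
            by (rule form_comb_holo_forms[OF A F'(1) F2(1) oS']) (use anti(2) s t in auto)
          have "diff_in \<A> ?L f Z0' \<F>'"
            by (rule diff_in_comb[OF A oS' _ F'(2) F2(2)])
              (use Z0(2) three(1) data' in \<open>auto simp: admissible_data_def\<close>)
          then have "G' s \<le> form_integral \<A> (?S' s) ?L (weight \<phi>' \<psi>' c')"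
            unfolding G'_def min_L2_def by (intro INF_lower) (use L in auto)
          also have "\<dots> = W'.energy c' (?S' s) (coord_coef P ?L)"
            by (rule I'[OF L order_refl W'.sublevel_measurable])
          also have "\<dots> = W'.energy c' (?S' s) (\<lambda>y. u y + of_real r * v y)"
          proof (rule W'.energy_cong[OF gc' W.coord_coef_measurable[OF L] _ W'.sublevel_measurable])
            fix y assume y: "coord_point P y \<in> ?S' s"
            then have "coord_point P y \<in> ?S' T1" "coord_point P y \<in> ?S' t"
              using anti(2)[of T1 s] anti(2)[of t s] s t by auto
            then show "coord_coef P ?L y = u y + of_real r * v y"
              using y dom_holo_forms[OF L] dom_holo_forms[OF F2(1)] domF'
              by (simp add: u_def v_def x_def coord_coef_def coef_form_comb algebra_simps)
          qed measurable
          also have "G' s = W'.energy c' (?S' s) u"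
            using F'(3) s t I'[OF F'(1) anti(2)[of T1 s] W'.sublevel_measurable] by (simp add: G'_def u_def)
          finally show ?thesis .
        qed
        have ux: "(\<lambda>y. u y + v y) = x" by (simp add: v_def)
        have u_fin: "W'.energy c' (?S' t) u < \<infinity>"
          using min[of t 1] x_fin t by (simp add: ux)
        have "T \<le> t" using T12 t by simp
        have "W'.energy c (W'.shell t T2) u \<le> W'.energy c (W'.shell t T2) (\<lambda>y. u y + v y)"
          by (rule W'.energy_shell_le_if_minimal[OF gc gc' um vm \<open>T \<le> t\<close> t(2) u_fin _ min])
            (use x_fin in \<open>simp_all add: ux\<close>)
        then have "ennreal \<alpha> * c.gain_between t T2 \<le> W'.energy c (W'.shell t T2) x"
          using shell_u[OF t(1,2)] by (simp add: ux)
        also have "W'.shell t T2 = W.shell t T2"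
          using upper[OF t] by (simp add: W.shell_def W'.shell_def ST2)
        also have "W'.energy c (W.shell t T2) x = W.energy c (W.shell t T2) x"
          by (rule shell_weights[symmetric]) (use anti(1)[OF t(1)] in \<open>auto simp: W.shell_def\<close>)
        finally have 1: "ennreal \<alpha> * c.gain_between t T2 \<le> W.energy c (W.shell t T2) x" .
        have R: "F |` ?S T2 \<in> holo_forms \<A> (?S T2)"
          by (rule restrict_holo_forms[OF A F(1) oS anti(1)[OF t(2)]])
        have "diff_in \<A> (F |` ?S T2) f Z0 \<F>"
          using F(2) by (subst diff_in_cong[OF oS Z0(1)[of T2]]) (auto simp: coef_restrict)
        then have "G T2 \<le> form_integral \<A> (?S T2) (F |` ?S T2) (weight \<phi> \<psi> c)"
          unfolding G_def min_L2_def by (intro INF_lower) (use R in auto)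
        also have "\<dots> = W.energy c (?S T2) x"
          unfolding I[OF R order_refl W.sublevel_measurable]
          by (rule W.energy_cong[OF gc W.coord_coef_measurable[OF R] xm W.sublevel_measurable])
            (simp add: x_def dom_holo_forms[OF F(1)] anti(1)[OF t(2)] coord_coef_restrict)
        finally have 2: "G T2 \<le> W.energy c (?S T2) x" .
        show ?thesis
          unfolding W.energy_sublevel[OF gc xm t(2)] by (rule add_mono[OF 1 2])
      qed (simp add: less_top[symmetric])
      then show "ennreal \<alpha> * c.gain_between t T2 + G T2 \<le> form_integral \<A> (?S t) F (weight \<phi> \<psi> c)"
        unfolding IF .
    qed
  qed

  \<comment> \<open>the slope is that of the given linear function; the constant is read off at \<open>T2\<close>\<close>
  show ?thesis
    unfolding linear_between_def
  proof (intro exI allI impI, elim conjE)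
    fix r :: real assume r: "0 \<le> r" "?h T2 \<le> ennreal r" "ennreal r \<le> ?h T1"
    obtain t where t: "T1 \<le> t" "t \<le> T2" "?h t = ennreal r"
      by (rule c.tail_IVT[OF T12 c(2) r])
    have inv: "inv_into {T..} ?h (ennreal r) = t"
      using c.inv_tail[OF c(2), of t] t T12 by simp
    have p: "c.gain_between t T2 = ennreal (r - enn2real (?h T2))"
      using c.tail_real_diff[of T2 t] t T12 c(2) r(1) by simp
    have d: "0 \<le> r - enn2real (?h T2)"
      using r by (metis diff_ge_0_iff_ge enn2real_ennreal enn2real_mono ennreal_less_top)
    have "G t = ennreal (\<alpha> * (r - enn2real (?h T2))) + ennreal (enn2real (G T2))"
      using G_eq[of t] t G2_fin \<alpha> d by (simp add: p ennreal_mult')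
    also have "\<dots> = ennreal (\<alpha> * (r - enn2real (?h T2)) + enn2real (G T2))"
      using \<alpha> d by (intro ennreal_plus[symmetric]) auto
    finally have "enn2ereal (G t) = ereal (\<alpha> * (r - enn2real (?h T2)) + enn2real (G T2))"
      using \<alpha> d by (simp only: enn2ereal_ennreal add_nonneg_nonneg mult_nonneg_nonneg enn2real_nonneg)
    then show "enn2ereal (min_L2 \<A> f Z0 \<F> (inv_into {T..} ?h (ennreal r)) \<phi> \<psi> c)
        = ereal (\<alpha> * r + (enn2real (G T2) - \<alpha> * enn2real (?h T2)))"
      unfolding inv G_def[symmetric] by (simp add: right_diff_distrib)
  qed
qed

end
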